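(* Let $n,d\ge1$ be integers, let $\mu$ be a probability measure on an open set $G\subset\mathbb{R}^n$ satisfying a Poincaré-type inequality with constant $\sigma^2>0$ (where $\sigma>0$), and let $f\colon G\to\mathbb{R}$ be a $\mathcal{C}^d$-smooth function with $\int_G f\,d\mu=0$. For any $t\ge 0$, set $$\eta_f(t):=\min\Big(\frac{\sqrt{2}\,t^{1/d}}{\sigma\lVert f^{(d)}\rVert_{\mathrm{Op},\infty}^{1/d}},\ \min_{k=1,\ldots,d-1}\frac{\sqrt{2}\,t^{1/k}}{\sigma\lVert f^{(k)}\rVert_{\mathrm{Op},2}^{1/k}}\Big).$$ Then, for any $t\ge 0$, $$\mu(|f|\ge t)\le \mathrm{e}^2\exp\big(-\eta_f(t)/(d\,\mathrm{e})\big).$$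
   Context: A Borel probability measure $\mu$ on an open set $G\subset\mathbb{R}^n$ satisfies a Poincaré-type inequality with constant $\sigma^2>0$ if for every bounded smooth function $g$ on $G$ with gradient $\nabla g$, $\mathrm{Var}_\mu(g)\le\sigma^2\int|\nabla g|^2\,d\mu$, where $\mathrm{Var}_\mu(g)=\int g^2\,d\mu-(\int g\,d\mu)^2$ and $|\cdot|$ is the Euclidean norm. The number $\sigma$ is always taken positive. For $f\in\mathcal{C}^d(G)$ and $1\le k\le d$, $f^{(k)}(x)$ is the (hyper-)matrix with entries $f^{(k)}_{i_1\ldots i_k}(x)=\partial_{i_1\ldots i_k}f(x)$, regarded as a symmetric multilinear $k$-form, and its operator norm is $|f^{(k)}(x)|_{\mathrm{Op}}=\sup\{f^{(k)}(x)[v_1,\ldots,v_k]\colon v_i\in\mathbb{R}^n,\ |v_1|=\cdots=|v_k|=1\}$. For $p\in(0,\infty)$, $\lVert f^{(k)}\rVert_{\mathrm{Op},p}=\big(\int_G|f^{(k)}|_{\mathrm{Op}}^p\,d\mu\big)^{1/p}\in[0,\infty]$, and $\lVert f^{(k)}\rVert_{\mathrm{Op},\infty}\in[0,\infty]$ is the $L^\infty(\mu)$-norm of $|f^{(k)}|_{\mathrm{Op}}$. Here $\mathrm{e}$ is Euler's number. In the definition of $\eta_f(t)$, a quotient whose denominator is $\infty$ equals $0$; a quotient whose denominator is $0$ equals $+\infty$ if $t>0$ and $0$ if $t=0$; the minimum over the empty set (case $d=1$) is $+\infty$; and $\exp(-\infty)=0$. *)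

theory Defs
  imports "HOL-Probability.Probability"
begin

section \<open>Smooth functions on an open subset of Euclidean space\<close>

definition pderiv_at :: "'n \<Rightarrow> (real ^ 'n::finite \<Rightarrow> real) \<Rightarrow> real ^ 'n \<Rightarrow> real" where
  "pderiv_at i f x = frechet_derivative f (at x) (axis i 1)"

text \<open>\<open>iter_pderiv [i\<^sub>1, \<dots>, i\<^sub>k] f\<close> is \<open>\<partial>\<^sub>i\<^sub>1 (\<dots> (\<partial>\<^sub>i\<^sub>k f))\<close>.\<close>

primrec iter_pderiv :: "'n list \<Rightarrow> (real ^ 'n::finite \<Rightarrow> real) \<Rightarrow> real ^ 'n \<Rightarrow> real" where
  "iter_pderiv [] f = f"
| "iter_pderiv (i # is) f = pderiv_at i (iter_pderiv is f)"

text \<open>Meant for open \<open>G\<close> only: the derivatives are taken at interior points, so the values of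
  \<open>f\<close> outside \<open>G\<close> play no role.\<close>

primrec Ck_on :: "nat \<Rightarrow> (real ^ 'n::finite) set \<Rightarrow> (real ^ 'n \<Rightarrow> real) \<Rightarrow> bool" where
  "Ck_on 0 G f \<longleftrightarrow> continuous_on G f"
| "Ck_on (Suc k) G f \<longleftrightarrow> f differentiable_on G \<and> (\<forall>i. Ck_on k G (pderiv_at i f))"

definition smooth_function_on :: "(real ^ 'n::finite) set \<Rightarrow> (real ^ 'n \<Rightarrow> real) \<Rightarrow> bool" where
  "smooth_function_on G f \<longleftrightarrow> (\<forall>k. Ck_on k G f)"

definition gradient :: "(real ^ 'n::finite \<Rightarrow> real) \<Rightarrow> real ^ 'n \<Rightarrow> real ^ 'n" where
  "gradient f x = (\<chi> i. pderiv_at i f x)"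

section \<open>Poincare-type inequalities\<close>

text \<open>The right-hand side may be infinite, hence the inequality is stated in \<^typ>\<open>ennreal\<close>;
  the variance of a bounded function is finite and nonnegative.\<close>

definition poincare_type ::
  "(real ^ 'n::finite) set \<Rightarrow> (real ^ 'n) measure \<Rightarrow> real \<Rightarrow> bool" where
  "poincare_type G \<mu> c \<longleftrightarrow>
    (\<forall>g. smooth_function_on G g \<and> bounded (g ` G) \<longrightarrow>
      ennreal ((\<integral>x. (g x)\<^sup>2 \<partial>\<mu>) - (\<integral>x. g x \<partial>\<mu>)\<^sup>2)
        \<le> ennreal c * (\<integral>\<^sup>+x. ennreal ((norm (gradient g x))\<^sup>2) \<partial>\<mu>))"

section \<open>Operator norms of higher derivatives\<close>

text \<open>The \<open>k\<close>-linear form \<open>f\<^sup>(\<^sup>k\<^sup>)(x)[v\<^sub>1, \<dots>, v\<^sub>k]\<close>; arguments are indexed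
  from \<open>0\<close>, so \<open>v j\<close> is the argument \<open>v\<^sub>j\<^sub>+\<^sub>1\<close>, and only \<open>v 0, \<dots>, v (k - 1)\<close> matter.\<close>

definition deriv_form ::
  "nat \<Rightarrow> (real ^ 'n::finite \<Rightarrow> real) \<Rightarrow> real ^ 'n \<Rightarrow> (nat \<Rightarrow> real ^ 'n) \<Rightarrow> real" where
  "deriv_form k f x v =
    (\<Sum>is\<in>{is. length is = k}. iter_pderiv is f x * (\<Prod>j<k. v j $ (is ! j)))"

text \<open>A real supremum: the set is nonempty and bounded above by the sum of the absolute values
  of the entries.\<close>

definition op_norm :: "nat \<Rightarrow> (real ^ 'n::finite \<Rightarrow> real) \<Rightarrow> real ^ 'n \<Rightarrow> real" where
  "op_norm k f x = (SUP v\<in>{v. \<forall>j<k. norm (v j) = 1}. deriv_form k f x v)"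

text \<open>Powers with exponent \<open>p > 0\<close> on \<open>[0, \<infinity>]\<close>.\<close>

definition ennreal_powr :: "ennreal \<Rightarrow> real \<Rightarrow> ennreal" where
  "ennreal_powr x p = (if x = \<infinity> then \<infinity> else ennreal (enn2real x powr p))"

definition op_norm_Lp ::
  "(real ^ 'n::finite) measure \<Rightarrow> nat \<Rightarrow> real \<Rightarrow> (real ^ 'n \<Rightarrow> real) \<Rightarrow> ennreal" where
  "op_norm_Lp \<mu> k p f =
    ennreal_powr (\<integral>\<^sup>+x. ennreal (op_norm k f x powr p) \<partial>\<mu>) (1 / p)"

definition op_norm_Linf ::
  "(real ^ 'n::finite) measure \<Rightarrow> nat \<Rightarrow> (real ^ 'n \<Rightarrow> real) \<Rightarrow> ennreal" where
  "op_norm_Linf \<mu> k f = esssup \<mu> (\<lambda>x. ennreal (op_norm k f x))"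

section \<open>The exponent\<close>

text \<open>In \<^typ>\<open>ennreal\<close> one has \<open>a / \<infinity> = 0\<close>, \<open>a / 0 = \<infinity>\<close> for \<open>a > 0\<close>, \<open>0 / 0 = 0\<close> and
  \<open>Inf {} = \<infinity>\<close>, which are exactly the intended conventions for the quotients and for the
  minimum over the empty range \<open>k = 1, \<dots>, d - 1\<close> when \<open>d = 1\<close>.\<close>

definition eta ::
  "(real ^ 'n::finite) measure \<Rightarrow> nat \<Rightarrow> real \<Rightarrow> (real ^ 'n \<Rightarrow> real) \<Rightarrow> real \<Rightarrow> ennreal" where
  "eta \<mu> d \<sigma> f t =
    min (ennreal (sqrt 2 * t powr (1 / real d))
          / (ennreal \<sigma> * ennreal_powr (op_norm_Linf \<mu> d f) (1 / real d)))
        (INF k\<in>{1..d - 1}. ennreal (sqrt 2 * t powr (1 / real k))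
          / (ennreal \<sigma> * ennreal_powr (op_norm_Lp \<mu> k 2 f) (1 / real k)))"

text \<open>\<open>exp (- x)\<close> for \<open>x \<in> [0, \<infinity>]\<close>, with \<open>exp (- \<infinity>) = 0\<close>.\<close>

definition exp_minus :: "ennreal \<Rightarrow> real" where
  "exp_minus x = (if x = \<infinity> then 0 else exp (- enn2real x))"

end

theory Submission
  imports Defs
begin

text \<open>A function \<open>u\<close> whose pointwise slope is dominated by a continuous function \<open>h\<close> can be
  approximated uniformly on \<open>G\<close> by smooth functions with gradient at most \<open>h + \<epsilon>\<close> (mollify locally and
  glue with a smooth partition of unity), so the Poincare-type inequality passes to such pairs \<open>(u, h)\<close>.
  Applied to \<open>u\<^sup>p\<^sup>/\<^sup>2\<close> with \<open>u \<ge> 0\<close>, together with Hoelder's inequality, it bounds the \<open>L\<^sup>p\<close> norm of \<open>u\<close> by its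
  \<open>L\<^sup>p\<^sup>/\<^sup>2\<close> norm and the \<open>L\<^sup>p\<close> norm of \<open>h\<close>; halving \<open>p\<close> repeatedly gives
  \<open>\<parallel>u\<parallel>\<^sub>p \<le> \<parallel>u\<parallel>\<^sub>2 + (\<sigma> p / \<surd>2) \<parallel>h\<parallel>\<^sub>p\<close> for \<open>p > 2\<close>, without the term \<open>\<parallel>u\<parallel>\<^sub>2\<close> if \<open>u\<close> has mean zero.
  Since the slope of the operator norm of \<open>f\<^sup>(\<^sup>k\<^sup>)\<close> is at most the operator norm of \<open>f\<^sup>(\<^sup>k\<^sup>+\<^sup>1\<^sup>)\<close>, iterating bounds
  \<open>\<parallel>f\<parallel>\<^sub>p\<close> by the sum of \<open>(\<sigma> p / \<surd>2)\<^sup>k \<parallel>f\<^sup>(\<^sup>k\<^sup>)\<parallel>\<^sub>2\<close> over \<open>k < d\<close> and \<open>(\<sigma> p / \<surd>2)\<^sup>d \<parallel>f\<^sup>(\<^sup>d\<^sup>)\<parallel>\<^sub>p\<close>. For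
  \<open>p = \<eta>\<^sub>f(t) / (d e)\<close> each of these \<open>d\<close> terms is at most \<open>t / (d e)\<close>, and Markov's inequality concludes.\<close>

section \<open>Calculus of \<open>C\<^sup>k\<close> functions\<close>

lemma pderiv_at_eq:
  assumes "(f has_derivative D) (at x)"
  shows "pderiv_at i f x = D (axis i 1)"
  using frechet_derivative_at[OF assms] by (simp add: pderiv_at_def)

lemma pderiv_at_cong:
  assumes "open G" "x \<in> G" "\<And>y. y \<in> G \<Longrightarrow> f y = g y"
  shows "pderiv_at i f x = pderiv_at i g x"
proof -
  have "(f has_derivative D) (at x) \<longleftrightarrow> (g has_derivative D) (at x)" for D
    using has_derivative_transform_within_open[of f D x UNIV G g]
      has_derivative_transform_within_open[of g D x UNIV G f] assms by auto
  then show ?thesis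
    by (simp add: pderiv_at_def frechet_derivative_def)
qed

lemma Ck_on_cong:
  assumes "open G" "\<And>y. y \<in> G \<Longrightarrow> f y = g y" "Ck_on k G f"
  shows "Ck_on k G g"
  using assms(2,3)
proof (induction k arbitrary: f g)
  case 0
  then show ?case
    using continuous_on_cong[of G G f g] by auto
next
  case (Suc k)
  have "g differentiable_on G"
    using Suc.prems differentiable_on_def differentiable_transform_within
    by (metis Ck_on.simps(2) zero_less_one)
  moreover have "Ck_on k G (pderiv_at i g)" for i
    using Suc.IH[of "pderiv_at i f" "pderiv_at i g"] Suc.prems
    by (simp add: pderiv_at_cong[OF assms(1) _ Suc.prems(1)])
  ultimately show ?case by simp
qed

lemma Ck_on_has_derivative:
  assumes "open G" "Ck_on (Suc k) G f" "x \<in> G"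
  shows "(f has_derivative frechet_derivative f (at x)) (at x)"
  using assms by (auto simp: differentiable_on_eq_differentiable_at frechet_derivative_works[symmetric])

lemma Ck_on_frechet_derivative:
  "Ck_on (Suc k) G f \<Longrightarrow> Ck_on k G (\<lambda>x. frechet_derivative f (at x) (axis i 1))"
  by (simp add: pderiv_at_def[abs_def])

text \<open>Lets any explicit family of derivatives \<open>D\<close> stand in for
  \<open>frechet_derivative\<close>; the sum, product and chain rules below all enter through
  it.\<close>

lemma Ck_on_SucI:
  assumes "open G" "\<And>x. x \<in> G \<Longrightarrow> (f has_derivative D x) (at x)"
    "\<And>i. Ck_on k G (\<lambda>x. D x (axis i 1))"
  shows "Ck_on (Suc k) G f"
proof -
  have "f differentiable_on G"
    using assms(1,2) by (auto simp: differentiable_on_eq_differentiable_at differentiable_def)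
  moreover have "Ck_on k G (pderiv_at i f)" for i
    using assms(2) by (intro Ck_on_cong[OF assms(1) _ assms(3)[of i]]) (simp add: pderiv_at_eq[OF assms(2)])
  ultimately show ?thesis by simp
qed

lemma Ck_on_subset: "Ck_on k G f \<Longrightarrow> H \<subseteq> G \<Longrightarrow> Ck_on k H f"
  by (induction k arbitrary: f) (auto intro: continuous_on_subset differentiable_on_subset)

lemma Ck_on_SucD: "Ck_on (Suc k) G f \<Longrightarrow> Ck_on k G f"
  by (induction k arbitrary: f) (auto intro: differentiable_imp_continuous_on)

lemma Ck_on_mono: "Ck_on k G f \<Longrightarrow> j \<le> k \<Longrightarrow> Ck_on j G f"
  by (induction k) (auto simp: le_Suc_eq dest: Ck_on_SucD simp del: Ck_on.simps)

lemma Ck_on_continuous: "Ck_on k G f \<Longrightarrow> continuous_on G f"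
  using Ck_on_mono[of k G f 0] by simp

text \<open>Continuity and differentiability are local on open sets. The glued approximation below
  is a fixed finite sum of smooth functions only on each set of an exhaustion, and this joins the
  pieces.\<close>

lemma Ck_on_UN:
  assumes "\<And>j. open (U j)" "\<And>j. Ck_on k (U j) f"
  shows "Ck_on k (\<Union>j. U j) f"
  using assms(2)
proof (induction k arbitrary: f)
  case 0
  then show ?case using assms(1) by (simp add: continuous_on_open_UN)
next
  case (Suc k)
  then show ?case
    using assms(1) by (auto simp: differentiable_on_eq_differentiable_at open_UN)
qed

lemma Ck_on_const: "Ck_on k G (\<lambda>x. c)"
proof (induction k arbitrary: c)
  case (Suc k)
  show ?case
    using Suc by (auto simp: pderiv_at_eq[OF has_derivative_const, abs_def])
qed simp

lemma Ck_on_add: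
  assumes "open G" "Ck_on k G f" "Ck_on k G g"
  shows "Ck_on k G (\<lambda>x. f x + g x)"
  using assms(2,3)
proof (induction k arbitrary: f g)
  case (Suc k)
  show ?case
  proof (rule Ck_on_SucI[OF assms(1)])
    show "((\<lambda>x. f x + g x) has_derivative
        (\<lambda>h. frechet_derivative f (at x) h + frechet_derivative g (at x) h)) (at x)" if "x \<in> G" for x
      by (intro has_derivative_add Ck_on_has_derivative[OF assms(1) Suc.prems(1) that] Ck_on_has_derivative[OF assms(1) Suc.prems(2) that])
    show "Ck_on k G (\<lambda>x. frechet_derivative f (at x) (axis i 1) + frechet_derivative g (at x) (axis i 1))" for i
      by (intro Suc.IH Ck_on_frechet_derivative Suc.prems)
  qed
qed (auto intro: continuous_on_add)

lemma Ck_on_mult: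
  assumes "open G" "Ck_on k G f" "Ck_on k G g"
  shows "Ck_on k G (\<lambda>x. f x * g x)"
  using assms(2,3)
proof (induction k arbitrary: f g)
  case (Suc k)
  show ?case
  proof (rule Ck_on_SucI[OF assms(1)])
    show "((\<lambda>x. f x * g x) has_derivative
        (\<lambda>h. f x * frechet_derivative g (at x) h + frechet_derivative f (at x) h * g x)) (at x)" if "x \<in> G" for x
      by (intro has_derivative_mult Ck_on_has_derivative[OF assms(1) Suc.prems(1) that] Ck_on_has_derivative[OF assms(1) Suc.prems(2) that])
    show "Ck_on k G (\<lambda>x. f x * frechet_derivative g (at x) (axis i 1) + frechet_derivative f (at x) (axis i 1) * g x)" for i
      by (intro Suc.IH Ck_on_add[OF assms(1)] Ck_on_frechet_derivative Suc.prems Suc.prems[THEN Ck_on_SucD])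
  qed
qed (auto intro: continuous_on_mult)

lemma Ck_on_diff:
  assumes "open G" "Ck_on k G f" "Ck_on k G g"
  shows "Ck_on k G (\<lambda>x. f x - g x)"
  using Ck_on_add[OF assms(1,2) Ck_on_mult[OF assms(1) Ck_on_const[of k G "- 1"] assms(3)]] by simp

lemma Ck_on_sum:
  assumes "open G" "\<And>j. j \<in> A \<Longrightarrow> Ck_on k G (f j)"
  shows "Ck_on k G (\<lambda>x. \<Sum>j\<in>A. f j x)"
  using assms(2)
  by (induction A rule: infinite_finite_induct) (auto intro!: Ck_on_const Ck_on_add[OF assms(1)])

lemma Ck_on_inner_self:
  fixes G :: "(real ^ 'n::finite) set"
  assumes "open G"
  shows "Ck_on k G (\<lambda>x. x \<bullet> x)"
proof -
  have lin: "Ck_on k G (\<lambda>x. x $ i)" for i k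
  proof (cases k)
    case (Suc j)
    then show ?thesis
      by (auto intro!: Ck_on_SucI[OF assms, where D = "\<lambda>x h. h $ i"] Ck_on_const
          bounded_linear_imp_has_derivative bounded_linear_vec_nth simp del: Ck_on.simps)
  qed (auto intro: continuous_intros)
  then show ?thesis
    unfolding inner_vec_def by (auto intro!: Ck_on_sum Ck_on_mult assms)
qed

text \<open>The sequence \<open>H\<close> lists a one-variable function with all its successive
  derivatives. The chain rule replaces \<open>H j\<close> by \<open>H (Suc j)\<close>, so the
  induction on \<open>k\<close> keeps \<open>j\<close> arbitrary.\<close>

lemma Ck_on_compose:
  fixes H :: "nat \<Rightarrow> real \<Rightarrow> real"
  assumes "open G" "\<And>j s. (H j has_real_derivative H (Suc j) s) (at s)" "Ck_on k G g"
  shows "Ck_on k G (\<lambda>x. H j (g x))"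
  using assms(3)
proof (induction k arbitrary: j g)
  case 0
  have "continuous_on UNIV (H j)"
    using assms(2) by (meson DERIV_isCont continuous_at_imp_continuous_on)
  with 0 show ?case
    by (auto intro: continuous_on_compose2)
next
  case (Suc k)
  show ?case
  proof (rule Ck_on_SucI[OF assms(1)])
    show "((\<lambda>x. H j (g x)) has_derivative (\<lambda>h. frechet_derivative g (at x) h * H (Suc j) (g x))) (at x)" if "x \<in> G" for x
      using has_derivative_compose[OF Ck_on_has_derivative[OF assms(1) Suc.prems that],
          of "H j" "\<lambda>h. h * H (Suc j) (g x)"] assms(2)[of j "g x"]
      by (simp add: has_field_derivative_def mult_commute_abs)
    show "Ck_on k G (\<lambda>x. frechet_derivative g (at x) (axis i 1) * H (Suc j) (g x))" for i
      by (intro Suc.IH Ck_on_mult[OF assms(1)] Ck_on_frechet_derivative Suc.prems Suc.prems[THEN Ck_on_SucD])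
  qed
qed

section \<open>Mollifiers\<close>

text \<open>For \<open>p = 1\<close> this is the standard flat function exp (-1/s), extended by 0.
  The polynomial factor in 1/s makes the family closed under differentiation, so smoothness at 0
  needs a single computation.\<close>

definition flat_fun :: "real poly \<Rightarrow> real \<Rightarrow> real" where
  "flat_fun p s = (if s > 0 then poly p (1 / s) * exp (- (1 / s)) else 0)"

text \<open>With t = 1/s the claim is that exp t outgrows every polynomial in t.\<close>

lemma flat_fun_tendsto_0:
  fixes p :: "real poly"
  shows "((\<lambda>s. poly p (1 / s) * exp (- (1 / s))) \<longlongrightarrow> 0) (at_right 0)"
proof -
  have "((\<lambda>t::real. (\<Sum>i\<le>degree p. coeff p i * (t ^ i / exp t))) \<longlongrightarrow> (\<Sum>i\<le>degree p. coeff p i * 0)) at_top"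
    by (intro tendsto_sum tendsto_mult tendsto_const tendsto_power_div_exp_0)
  then have "((\<lambda>t. poly p t * exp (- t)) \<longlongrightarrow> 0) at_top"
    by (simp add: poly_altdef sum_distrib_right exp_minus divide_inverse mult.assoc)
  then show ?thesis
    using filterlim_compose[OF _ filterlim_inverse_at_top_right, of "\<lambda>t. poly p t * exp (- t)"]
    by (simp add: inverse_eq_divide)
qed

text \<open>Here \<open>[:0, 0, 1:]\<close> is the polynomial X^2: for s > 0 the derivative of
  p(1/s) exp(-1/s) is (1/s)^2 (p(1/s) - p'(1/s)) exp(-1/s).\<close>

lemma flat_fun_deriv:
  "(flat_fun p has_real_derivative flat_fun ([:0, 0, 1:] * (p - pderiv p)) s) (at s)"
proof -
  consider "s > 0" | "s < 0" | "s = 0" by linarith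
  then show ?thesis
  proof cases
    case 1
    have "((\<lambda>s. poly p (1 / s) * exp (- (1 / s))) has_real_derivative
        flat_fun ([:0, 0, 1:] * (p - pderiv p)) s) (at s)"
      using 1 by (auto intro!: derivative_eq_intros poly_DERIV[THEN DERIV_chain2]
          simp: flat_fun_def field_simps power2_eq_square)
    then show ?thesis
      by (rule DERIV_cong_ev[OF refl _ refl, THEN iffD1, rotated])
        (use 1 in \<open>auto simp: flat_fun_def intro!: eventually_nhds_in_open[of "{0<..}", THEN eventually_mono]\<close>)
  next
    case 2
    have "((\<lambda>s. 0) has_real_derivative 0) (at s)" by simp
    then have "(flat_fun p has_real_derivative 0) (at s)"
      by (rule DERIV_cong_ev[OF refl _ refl, THEN iffD1, rotated])
        (use 2 in \<open>auto simp: flat_fun_def intro!: eventually_nhds_in_open[of "{..<0}", THEN eventually_mono]\<close>)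
    then show ?thesis using 2 by (simp add: flat_fun_def)
  next
    case 3
    \<comment> \<open>The polynomial \<open>pCons 0 p\<close> is X p; its factor X absorbs the
      division by y in the difference quotient.\<close>
    have "((\<lambda>y. flat_fun p y / y) \<longlongrightarrow> 0) (at_right 0)"
      using flat_fun_tendsto_0[of "pCons 0 p"]
      by (rule filterlim_cong[OF refl refl, THEN iffD1, rotated])
        (auto simp: flat_fun_def eventually_at_filter)
    moreover have "((\<lambda>y. flat_fun p y / y) \<longlongrightarrow> 0) (at_left 0)"
      by (rule tendsto_eventually) (auto simp: flat_fun_def eventually_at_filter)
    ultimately have "((\<lambda>y. flat_fun p y / y) \<longlongrightarrow> 0) (at 0)"
      by (simp add: filterlim_split_at)
    then show ?thesis using 3 by (simp add: has_field_derivative_iff flat_fun_def)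
  qed
qed

text \<open>Iterating the map p to X^2 (p - p') on polynomials supplies the sequence of derivatives
  that \<open>Ck_on_compose\<close> asks for.\<close>

lemma Ck_on_flat_fun:
  assumes "open G" "Ck_on k G g"
  shows "Ck_on k G (\<lambda>x. flat_fun p (g x))"
  using Ck_on_compose[OF assms(1), of "\<lambda>j. flat_fun (((\<lambda>p. [:0, 0, 1:] * (p - pderiv p)) ^^ j) p)" k g 0] assms(2)
  by (simp add: flat_fun_deriv del: mult_pCons_left)

section \<open>Construction of mollifiers\<close>

lemma integrable_compact_support:
  fixes f :: "'a::euclidean_space \<Rightarrow> real"
  assumes "continuous_on UNIV f" "compact K" "\<And>x. x \<notin> K \<Longrightarrow> f x = 0"
  shows "integrable lborel f"
proof -
  have "integrable lborel (\<lambda>x. indicator K x *\<^sub>R f x)"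
    using assms by (intro borel_integrable_compact) (auto intro: continuous_on_subset)
  moreover have "(\<lambda>x. indicator K x *\<^sub>R f x) = f"
    using assms(3) by (intro ext) (auto simp: indicator_def of_bool_def)
  ultimately show ?thesis by simp
qed

text \<open>Evenness turns the integral of \<open>\<phi> (x - y)\<close> over \<open>y\<close> into
  that of a translate of \<open>\<phi>\<close>.\<close>

definition mollifier :: "real \<Rightarrow> (real ^ 'n::finite \<Rightarrow> real) \<Rightarrow> bool" where
  "mollifier \<delta> \<phi> \<longleftrightarrow> smooth_function_on UNIV \<phi> \<and> (\<forall>x. \<phi> x \<ge> 0) \<and> (\<forall>x. \<phi> (- x) = \<phi> x) \<and>
    (\<forall>x. norm x \<ge> \<delta> \<longrightarrow> \<phi> x = 0) \<and> (\<integral>x. \<phi> x \<partial>lborel) = 1"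

lemma mollifier_exists:
  assumes "0 < \<delta>"
  shows "\<exists>\<phi> :: real ^ 'n::finite \<Rightarrow> real. mollifier \<delta> \<phi>"
proof -
  \<comment> \<open>Inside the ball of radius \<open>\<delta>\<close> this is exp (-1/(delta^2 -
    |x|^2)), outside it is 0. The squared norm keeps the inner function polynomial, hence smooth at
    the origin.\<close>
  define \<psi> :: "real ^ 'n \<Rightarrow> real" where "\<psi> x = flat_fun 1 (\<delta>\<^sup>2 - x \<bullet> x)" for x
  have sm: "Ck_on k UNIV \<psi>" for k
    unfolding \<psi>_def by (intro Ck_on_flat_fun Ck_on_diff Ck_on_const Ck_on_inner_self open_UNIV)
  have nn: "\<psi> x \<ge> 0" for x by (simp add: \<psi>_def flat_fun_def)
  have pos: "\<psi> x > 0" if "norm x < \<delta>" for x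
    using that power2_norm_eq_inner[of x] power_strict_mono[of "norm x" \<delta> 2]
    by (simp add: \<psi>_def flat_fun_def)
  have out: "\<psi> x = 0" if "norm x \<ge> \<delta>" for x
    using that power2_norm_eq_inner[of x] power_mono[of \<delta> "norm x" 2] assms
    by (simp add: \<psi>_def flat_fun_def)
  have int: "integrable lborel \<psi>"
    by (rule integrable_compact_support[of _ "cball 0 \<delta>"]) (auto simp: out Ck_on_continuous[OF sm])
  \<comment> \<open>A vanishing integral would make \<open>\<psi>\<close> zero almost everywhere,
    although it is positive on a ball, which is not negligible.\<close>
  have "(\<integral>x. \<psi> x \<partial>lborel) \<noteq> 0"
  proof
    assume "(\<integral>x. \<psi> x \<partial>lborel) = 0"
    then have "AE x in lborel. \<psi> x = 0"
      using integral_nonneg_eq_0_iff_AE[OF int] nn by auto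
    then have "AE x in lborel. x \<notin> ball (0::real^'n) \<delta>"
      by (rule AE_mp) (use pos in \<open>auto intro!: AE_I2 simp: less_le\<close>)
    then have "emeasure lborel (ball (0::real^'n) \<delta>) = 0"
      by (subst (asm) AE_iff_measurable[OF _ refl]) (auto simp: ball_def)
    then have "negligible (ball (0::real^'n) \<delta>)"
      by (simp add: negligible_iff_emeasure0)
    then show False
      using assms open_not_negligible[of "ball (0::real^'n) \<delta>"] by auto
  qed
  then have I: "(\<integral>x. \<psi> x \<partial>lborel) > 0"
    using Bochner_Integration.integral_nonneg[of lborel \<psi>, OF nn] by linarith
  let ?c = "1 / (\<integral>x. \<psi> x \<partial>lborel)"
  have "smooth_function_on UNIV (\<lambda>x. ?c * \<psi> x)"
    unfolding smooth_function_on_def by (intro allI Ck_on_mult Ck_on_const sm open_UNIV)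
  moreover have "(\<integral>x. ?c * \<psi> x \<partial>lborel) = 1" using I by simp
  moreover have "\<psi> (- x) = \<psi> x" for x by (simp add: \<psi>_def)
  ultimately have "mollifier \<delta> (\<lambda>x. ?c * \<psi> x)"
    unfolding mollifier_def using nn out I by simp
  then show ?thesis by (rule exI[of "mollifier \<delta>"])
qed

lemma smooth_function_on_Ck_on: "smooth_function_on G f \<Longrightarrow> Ck_on k G f"
  by (simp add: smooth_function_on_def)

lemma smooth_function_on_pderiv_at: "smooth_function_on G f \<Longrightarrow> smooth_function_on G (pderiv_at i f)"
  unfolding smooth_function_on_def by (metis Ck_on.simps(2))

lemma has_derivative_gradient:
  assumes "f differentiable at x"
  shows "(f has_derivative (\<lambda>h. gradient f x \<bullet> h)) (at x)"
proof -
  let ?D = "frechet_derivative f (at x)"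
  have D: "(f has_derivative ?D) (at x)"
    using assms by (simp add: frechet_derivative_works)
  interpret linear ?D
    using assms by (rule linear_frechet_derivative)
  have "?D h = gradient f x \<bullet> h" for h
  proof -
    have "?D h = ?D (\<Sum>i\<in>UNIV. h $ i *s axis i 1)"
      by (simp add: basis_expansion)
    also have "\<dots> = (\<Sum>i\<in>UNIV. h $ i * ?D (axis i 1))"
      by (simp add: sum scale scalar_mult_eq_scaleR)
    finally show ?thesis
      by (simp add: gradient_def inner_vec_def pderiv_at_def mult.commute)
  qed
  then have "?D = (\<lambda>h. gradient f x \<bullet> h)" by blast
  with D show ?thesis by simp
qed

section \<open>Convolution and its smoothness\<close>

definition convolve :: "(real ^ 'n::finite \<Rightarrow> real) \<Rightarrow> (real ^ 'n \<Rightarrow> real) \<Rightarrow> real ^ 'n \<Rightarrow> real" where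
  "convolve v \<phi> x = (\<integral>y. v y * \<phi> (x - y) \<partial>lborel)"

text \<open>Differentiation under the integral sign puts every derivative on \<open>\<phi>\<close>,
  while \<open>v\<close> is only continuous. The partial derivatives are again convolutions with the
  same \<open>v\<close>, which is the form that the induction for smoothness needs.\<close>

lemma convolve_has_derivative:
  fixes v \<phi> :: "real ^ 'n::finite \<Rightarrow> real"
  assumes v: "continuous_on UNIV v" "compact K" "\<And>y. y \<notin> K \<Longrightarrow> v y = 0"
    and \<phi>: "Ck_on 1 UNIV \<phi>"
  shows "\<exists>D. (convolve v \<phi> has_derivative D) (at x) \<and> (\<forall>i. D (axis i 1) = convolve v (pderiv_at i \<phi>) x)"
proof -
  \<comment> \<open>The Leibniz rule is about integrals over a box, so the support of
    \<open>v\<close> is enclosed in one.\<close>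
  obtain a b where ab: "K \<subseteq> cbox a b"
    using bounded_subset_cbox_symmetric[OF compact_imp_bounded[OF v(2)]] by metis
  have grad: "continuous_on UNIV (gradient \<phi>)"
    unfolding gradient_def[abs_def] using \<phi> by (intro continuous_on_vec_lambda) simp
  have conv: "convolve v \<psi> x = integral (cbox a b) (\<lambda>y. v y * \<psi> (x - y))" if "continuous_on UNIV \<psi>" for \<psi> x
  proof -
    have "integrable lborel (\<lambda>y. v y * \<psi> (x - y))"
      by (rule integrable_compact_support[OF _ v(2)])
        (auto simp: v(3) intro!: continuous_on_mult v(1) continuous_on_compose2[OF that] continuous_intros)
    then have "convolve v \<psi> x = integral UNIV (\<lambda>y. v y * \<psi> (x - y))"
      by (simp add: convolve_def integral_lborel)
    also have "(\<lambda>y. v y * \<psi> (x - y)) = (\<lambda>y. if y \<in> cbox a b then v y * \<psi> (x - y) else 0)"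
      using ab v(3) by (intro ext) auto
    finally show ?thesis by (simp add: integral_restrict_UNIV)
  qed
  \<comment> \<open>The derivative of the integrand in \<open>x\<close>, as a bounded linear map
    that is jointly continuous in \<open>x\<close> and \<open>t\<close>.\<close>
  define F where "F x t = blinfun_inner_right (v t *\<^sub>R gradient \<phi> (x - t))" for x t
  have F: "blinfun_apply (F x t) h = v t * (gradient \<phi> (x - t) \<bullet> h)" for x t h
    by (simp add: F_def)
  have contF: "continuous_on (UNIV \<times> cbox a b) (\<lambda>(x, t). F x t)"
    unfolding F_def split_beta
    by (intro bounded_linear.continuous_on[OF bounded_linear_blinfun_inner_right] continuous_on_scaleR
        continuous_on_compose2[OF grad] continuous_on_compose2[OF v(1)] continuous_intros) auto
  have cont\<phi>: "continuous_on UNIV \<phi>"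
    using \<phi> by (rule Ck_on_continuous)
  have "((\<lambda>x. integral (cbox a b) (\<lambda>t. v t * \<phi> (x - t))) has_derivative integral (cbox a b) (F x)) (at x within UNIV)"
  proof (rule leibniz_rule[OF _ _ contF])
    show "((\<lambda>x. v t * \<phi> (x - t)) has_derivative blinfun_apply (F x t)) (at x within UNIV)" for x t
    proof -
      have "\<phi> differentiable at (x - t)"
        using \<phi> by (auto simp: differentiable_on_def)
      then have "(\<phi> has_derivative (\<lambda>h. gradient \<phi> (x - t) \<bullet> h)) (at (x - t))"
        by (rule has_derivative_gradient)
      moreover have "((\<lambda>x. x - t) has_derivative (\<lambda>h. h)) (at x)"
        by (auto intro!: derivative_eq_intros)
      ultimately have "((\<lambda>x. \<phi> (x - t)) has_derivative (\<lambda>h. gradient \<phi> (x - t) \<bullet> h)) (at x)"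
        using has_derivative_compose by blast
      then show ?thesis unfolding F by (intro has_derivative_mult_right)
    qed
    show "(\<lambda>t. v t * \<phi> (x - t)) integrable_on cbox a b" for x
      by (intro integrable_continuous continuous_on_mult continuous_on_compose2[OF cont\<phi>]
          continuous_on_subset[OF v(1)] continuous_intros) auto
  qed auto
  moreover have "convolve v \<phi> = (\<lambda>x. integral (cbox a b) (\<lambda>t. v t * \<phi> (x - t)))"
    by (intro ext conv cont\<phi>)
  ultimately have "(convolve v \<phi> has_derivative integral (cbox a b) (F x)) (at x)" by simp
  moreover have "integral (cbox a b) (F x) (axis i 1) = convolve v (pderiv_at i \<phi>) x" for i
  proof -
    have "continuous_on (cbox a b) (\<lambda>t. (x, t))"
      by (intro continuous_intros)
    from continuous_on_compose2[OF contF this] have "continuous_on (cbox a b) (F x)"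
      by auto
    then have "F x integrable_on cbox a b" by (rule integrable_continuous)
    then have "integral (cbox a b) (F x) (axis i 1) = integral (cbox a b) (\<lambda>t. F x t (axis i 1))"
      by (rule blinfun_apply_integral)
    also have "\<dots> = integral (cbox a b) (\<lambda>t. v t * pderiv_at i \<phi> (x - t))"
      by (simp add: F gradient_def inner_axis)
    also have "\<dots> = convolve v (pderiv_at i \<phi>) x"
      using \<phi> by (intro conv[symmetric]) simp
    finally show ?thesis .
  qed
  ultimately show ?thesis by blast
qed

lemma smooth_convolve:
  fixes v \<phi> :: "real ^ 'n::finite \<Rightarrow> real"
  assumes v: "continuous_on UNIV v" "compact K" "\<And>y. y \<notin> K \<Longrightarrow> v y = 0"
    and "smooth_function_on UNIV \<phi>"
  shows "smooth_function_on UNIV (convolve v \<phi>)"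
proof -
  have "Ck_on k UNIV (convolve v \<phi>)" for k
    using assms(4)
  proof (induction k arbitrary: \<phi>)
    case 0
    have "isCont (convolve v \<phi>) x" for x
      using convolve_has_derivative[OF v smooth_function_on_Ck_on[OF 0]] has_derivative_continuous by blast
    then show ?case by (simp add: continuous_at_imp_continuous_on)
  next
    case (Suc k)
    obtain D where D: "(convolve v \<phi> has_derivative D x) (at x)"
        "D x (axis i 1) = convolve v (pderiv_at i \<phi>) x" for x i
      using convolve_has_derivative[OF v smooth_function_on_Ck_on[OF Suc.prems]] by metis
    show ?case
    proof (rule Ck_on_SucI[OF open_UNIV D(1)])
      show "Ck_on k UNIV (\<lambda>x. D x (axis i 1))" for i
        using Suc.IH[OF smooth_function_on_pderiv_at[OF Suc.prems]] by (simp add: D(2))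
    qed
  qed
  then show ?thesis by (simp add: smooth_function_on_def)
qed

lemma mollifier_continuous: "mollifier \<delta> \<phi> \<Longrightarrow> continuous_on UNIV \<phi>"
  unfolding mollifier_def using smooth_function_on_Ck_on Ck_on_continuous by blast

lemma lborel_integral_translate:
  fixes F :: "'a::euclidean_space \<Rightarrow> real"
  assumes "F \<in> borel_measurable borel"
  shows "(\<integral>y. F (w + y) \<partial>lborel) = (\<integral>y. F y \<partial>lborel)"
  using integral_distr[of "(+) w" lborel borel F] assms by (simp add: lborel_distr_plus)

lemma integrable_convolve:
  fixes v \<phi> :: "real ^ 'n::finite \<Rightarrow> real"
  assumes "mollifier \<delta> \<phi>" "continuous_on UNIV v"
  shows "integrable lborel (\<lambda>y. v y * \<phi> (x - y))"
  using assms(1)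
  by (intro integrable_compact_support[of _ "cball x \<delta>"])
    (auto simp: mollifier_def dist_norm intro!: continuous_on_mult assms(2)
      continuous_on_compose2[OF mollifier_continuous[OF assms(1)]] continuous_intros)

lemma mollifier_shifted_integral:
  assumes "mollifier \<delta> \<phi>"
  shows "(\<integral>y. \<phi> (x - y) \<partial>lborel) = 1"
proof -
  have "(\<integral>y. \<phi> (x - y) \<partial>lborel) = (\<integral>y. \<phi> (- x + y) \<partial>lborel)"
    using assms unfolding mollifier_def by (metis diff_conv_add_uminus minus_diff_eq uminus_add_conv_diff)
  also have "\<dots> = 1"
    using assms lborel_integral_translate[of \<phi> "- x"]
    by (simp add: mollifier_def borel_measurable_continuous_onI[OF mollifier_continuous[OF assms]])
  finally show ?thesis .
qed

text \<open>Convolution with a mollifier averages \<open>v\<close> over the ball of radius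
  \<open>\<delta>\<close>. Centre \<open>a\<close> and tolerance \<open>e\<close> are free, so one
  statement covers approximation, range bounds and exact values.\<close>

lemma convolve_near:
  fixes v \<phi> :: "real ^ 'n::finite \<Rightarrow> real"
  assumes \<phi>: "mollifier \<delta> \<phi>" and v: "continuous_on UNIV v"
    and near: "\<And>y. dist x y < \<delta> \<Longrightarrow> \<bar>v y - a\<bar> \<le> e"
  shows "\<bar>convolve v \<phi> x - a\<bar> \<le> e"
proof -
  have int1: "integrable lborel (\<lambda>y. \<phi> (x - y))"
    using integrable_convolve[OF \<phi>, of "\<lambda>_. 1"] by simp
  have "convolve v \<phi> x - a = (\<integral>y. v y * \<phi> (x - y) - a * \<phi> (x - y) \<partial>lborel)"
    using integrable_convolve[OF \<phi> v] int1
    by (simp add: convolve_def Bochner_Integration.integral_diff mollifier_shifted_integral[OF \<phi>])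
  also have "\<bar>\<dots>\<bar> \<le> (\<integral>y. e * \<phi> (x - y) \<partial>lborel)"
    unfolding real_norm_def[symmetric]
  proof (rule Bochner_Integration.integral_norm_bound_integral)
    show "integrable lborel (\<lambda>y. v y * \<phi> (x - y) - a * \<phi> (x - y))"
      using integrable_convolve[OF \<phi> v] int1 by simp
    show "integrable lborel (\<lambda>y. e * \<phi> (x - y))" using int1 by simp
    fix y
    show "norm (v y * \<phi> (x - y) - a * \<phi> (x - y)) \<le> e * \<phi> (x - y)"
    proof (cases "dist x y < \<delta>")
      case True
      then show ?thesis
        using near[OF True] \<phi> mult_right_mono[of "\<bar>v y - a\<bar>" e "\<phi> (x - y)"]
        by (simp add: mollifier_def abs_mult left_diff_distrib[symmetric])
    next
      case False
      then show ?thesis using \<phi> by (simp add: mollifier_def dist_norm)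
    qed
  qed
  also have "\<dots> = e" by (simp add: mollifier_shifted_integral[OF \<phi>])
  finally show ?thesis .
qed

text \<open>Convolution commutes with translation, so a bound on the increments of \<open>v\<close>
  along a fixed vector \<open>w\<close> survives averaging. This is how Lipschitz and slope bounds
  pass to mollified functions.\<close>

lemma convolve_translate:
  fixes v \<phi> :: "real ^ 'n::finite \<Rightarrow> real"
  assumes \<phi>: "mollifier \<delta> \<phi>" and v: "continuous_on UNIV v"
    and near: "\<And>y. dist x y < \<delta> \<Longrightarrow> \<bar>v (w + y) - v y\<bar> \<le> e"
  shows "\<bar>convolve v \<phi> (w + x) - convolve v \<phi> x\<bar> \<le> e"
proof -
  have cw: "continuous_on UNIV (\<lambda>y. v (w + y))"
    by (intro continuous_on_compose2[OF v] continuous_intros) auto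
  have "continuous_on UNIV (\<lambda>y. v y * \<phi> (w + x - y))"
    by (intro continuous_on_mult v continuous_on_compose2[OF mollifier_continuous[OF \<phi>]] continuous_intros) auto
  from lborel_integral_translate[OF borel_measurable_continuous_onI[OF this], of w]
  have "convolve v \<phi> (w + x) = convolve (\<lambda>y. v (w + y)) \<phi> x"
    by (simp add: convolve_def)
  then have "convolve v \<phi> (w + x) - convolve v \<phi> x = convolve (\<lambda>y. v (w + y) - v y) \<phi> x"
    using integrable_convolve[OF \<phi> v, of x] integrable_convolve[OF \<phi> cw, of x]
    by (simp add: convolve_def left_diff_distrib)
  then show ?thesis
    using convolve_near[OF \<phi> continuous_on_diff[OF cw v], of x 0 e] near by simp
qed

section \<open>Smooth approximation\<close>

text \<open>\<open>h\<close> dominates the upper limit of the difference quotients of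
  \<open>u\<close>. Unlike a gradient bound this makes sense for functions that need not be
  differentiable, such as truncations, absolute values and operator norms of derivatives.\<close>

definition slope_on :: "'a::real_normed_vector set \<Rightarrow> ('a \<Rightarrow> real) \<Rightarrow> ('a \<Rightarrow> real) \<Rightarrow> bool" where
  "slope_on G u h \<longleftrightarrow> (\<forall>x\<in>G. \<forall>\<epsilon>>0. \<forall>\<^sub>F y in nhds x. \<bar>u y - u x\<bar> \<le> (h x + \<epsilon>) * dist y x)"

text \<open>Near every point of the segment from \<open>x\<close> to \<open>y\<close>, the increment
  from that point is at most \<open>M\<close> times the distance, and such bounds add up over
  adjacent intervals. Bisection (\<open>Bolzano\<close>) passes from short intervals to the whole
  segment. The strict inequality \<open>h z < M\<close> provides the \<open>\<epsilon>\<close> of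
  \<open>slope_on\<close>.\<close>

lemma slope_on_lipschitz:
  fixes x y :: "'a::real_normed_vector"
  assumes "slope_on G u h" "convex C" "C \<subseteq> G" "\<And>z. z \<in> C \<Longrightarrow> h z < M" "x \<in> C" "y \<in> C"
  shows "\<bar>u y - u x\<bar> \<le> M * dist y x"
proof -
  define \<gamma> where "\<gamma> s = x + s *\<^sub>R (y - x)" for s
  have cont: "continuous_on UNIV \<gamma>" unfolding \<gamma>_def by (intro continuous_intros)
  have d: "dist (\<gamma> s) (\<gamma> t) = \<bar>s - t\<bar> * dist y x" for s t
    by (simp add: \<gamma>_def dist_norm scaleR_diff_left[symmetric] del: scaleR_diff_left)
  have "0 \<le> (0::real) \<and> (1::real) \<le> 1 \<longrightarrow> \<bar>u (\<gamma> 1) - u (\<gamma> 0)\<bar> \<le> M * (1 - 0) * dist y x"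
  proof (rule Bolzano[of 0 1 "\<lambda>a b. 0 \<le> a \<and> b \<le> 1 \<longrightarrow> \<bar>u (\<gamma> b) - u (\<gamma> a)\<bar> \<le> M * (b - a) * dist y x"])
    fix s :: real assume s: "0 \<le> s" "s \<le> 1"
    then have C: "\<gamma> s \<in> C"
      using convexD_alt[OF assms(2,5,6), of s] by (simp add: \<gamma>_def algebra_simps)
    have "\<forall>\<^sub>F z in nhds (\<gamma> s). \<bar>u z - u (\<gamma> s)\<bar> \<le> (h (\<gamma> s) + (M - h (\<gamma> s))) * dist z (\<gamma> s)"
      using assms(1,3) C assms(4)[OF C] unfolding slope_on_def by (meson diff_gt_0_iff_gt subsetD)
    then have "\<forall>\<^sub>F z in nhds (\<gamma> s). \<bar>u z - u (\<gamma> s)\<bar> \<le> M * dist z (\<gamma> s)" by simp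
    moreover have "filterlim \<gamma> (nhds (\<gamma> s)) (nhds s)"
      using cont by (simp add: continuous_on_eq_continuous_at isCont_def tendsto_nhds_iff)
    ultimately have "\<forall>\<^sub>F t in nhds s. \<bar>u (\<gamma> t) - u (\<gamma> s)\<bar> \<le> M * dist (\<gamma> t) (\<gamma> s)"
      by (rule eventually_compose_filterlim)
    then obtain \<delta> where \<delta>: "\<delta> > 0" "\<And>t. \<bar>t - s\<bar> < \<delta> \<Longrightarrow> \<bar>u (\<gamma> t) - u (\<gamma> s)\<bar> \<le> M * (\<bar>t - s\<bar> * dist y x)"
      by (auto simp: eventually_nhds_metric dist_real_def d)
    show "\<exists>d>0. \<forall>a b. a \<le> s \<and> s \<le> b \<and> b - a < d \<longrightarrow>
        0 \<le> a \<and> b \<le> 1 \<longrightarrow> \<bar>u (\<gamma> b) - u (\<gamma> a)\<bar> \<le> M * (b - a) * dist y x"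
    proof (intro exI[of _ \<delta>] conjI allI impI \<delta>(1))
      fix a b assume "a \<le> s \<and> s \<le> b \<and> b - a < \<delta>"
      then have "\<bar>u (\<gamma> a) - u (\<gamma> s)\<bar> \<le> M * ((s - a) * dist y x)" "\<bar>u (\<gamma> b) - u (\<gamma> s)\<bar> \<le> M * ((b - s) * dist y x)"
        using \<delta>(2)[of a] \<delta>(2)[of b] by auto
      moreover have "M * (b - a) * dist y x = M * ((s - a) * dist y x) + M * ((b - s) * dist y x)"
        by (simp add: algebra_simps)
      ultimately show "\<bar>u (\<gamma> b) - u (\<gamma> a)\<bar> \<le> M * (b - a) * dist y x" by linarith
    qed
  next
    fix a b c
    assume ab: "0 \<le> a \<and> b \<le> 1 \<longrightarrow> \<bar>u (\<gamma> b) - u (\<gamma> a)\<bar> \<le> M * (b - a) * dist y x"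
      and bc: "0 \<le> b \<and> c \<le> 1 \<longrightarrow> \<bar>u (\<gamma> c) - u (\<gamma> b)\<bar> \<le> M * (c - b) * dist y x" and le: "a \<le> b" "b \<le> c"
    have "M * (c - a) * dist y x = M * (b - a) * dist y x + M * (c - b) * dist y x"
      by (simp add: algebra_simps)
    then show "0 \<le> a \<and> c \<le> 1 \<longrightarrow> \<bar>u (\<gamma> c) - u (\<gamma> a)\<bar> \<le> M * (c - a) * dist y x"
      using ab bc le by linarith
  qed simp
  then show ?thesis by (simp add: \<gamma>_def)
qed

lemma compact_open_infdist:
  fixes K :: "'a::euclidean_space set"
  assumes "compact K" "open U" "K \<subseteq> U" "K \<noteq> {}"
  obtains r where "r > 0" "\<And>y. infdist y K \<le> 2 * r \<Longrightarrow> y \<in> U"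
proof -
  obtain e where e: "e > 0" "(\<Union>x\<in>K. ball x e) \<subseteq> U"
    using compact_subset_open_imp_ball_epsilon_subset[OF assms(1-3)] by blast
  show ?thesis
  proof (rule that[of "e / 4"])
    fix y assume y: "infdist y K \<le> 2 * (e / 4)"
    obtain x where "x \<in> K" "infdist y K = dist y x"
      using infdist_attains_inf[OF compact_imp_closed[OF assms(1)] assms(4)] by blast
    then have "x \<in> K" "y \<in> ball x e" using y e(1) by (auto simp: dist_commute)
    then show "y \<in> U" using e(2) by blast
  qed (use e in simp)
qed

section \<open>Smooth cutoff functions\<close>

definition plateau :: "'a::metric_space set \<Rightarrow> real \<Rightarrow> 'a \<Rightarrow> real" where
  "plateau K r y = max 0 (min 1 (2 - infdist y K / r))"

lemma plateau_continuous: "r > 0 \<Longrightarrow> continuous_on S (plateau K r)"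
  unfolding plateau_def[abs_def] by (intro continuous_intros) auto

lemma plateau_range: "0 \<le> plateau K r y" "plateau K r y \<le> 1"
  by (auto simp: plateau_def)

lemma plateau_eq_1: "r > 0 \<Longrightarrow> infdist y K \<le> r \<Longrightarrow> plateau K r y = 1"
  by (simp add: plateau_def field_simps)

lemma plateau_eq_0: "r > 0 \<Longrightarrow> infdist y K \<ge> 2 * r \<Longrightarrow> plateau K r y = 0"
  by (simp add: plateau_def field_simps)

lemma plateau_lipschitz:
  assumes "r > 0"
  shows "\<bar>plateau K r y - plateau K r x\<bar> \<le> dist y x / r"
proof -
  have "\<bar>plateau K r y - plateau K r x\<bar> \<le> \<bar>infdist y K / r - infdist x K / r\<bar>"
    by (auto simp: plateau_def)
  also have "\<dots> = \<bar>infdist y K - infdist x K\<bar> / r"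
    using assms by (simp add: diff_divide_distrib[symmetric])
  also have "\<dots> \<le> dist y x / r"
    using assms by (intro divide_right_mono infdist_triangle_abs) auto
  finally show ?thesis .
qed

text \<open>The plateau is 1 up to distance \<open>r\<close> from \<open>K\<close> and 0 beyond
  \<open>2 * r\<close>. Mollifying at scale \<open>r\<close> keeps the value 1 on \<open>K\<close>,
  vanishes from distance \<open>3 * r\<close> on, and preserves the Lipschitz constant
  \<open>1 / r\<close>.\<close>

lemma smooth_cutoff:
  fixes K U :: "(real ^ 'n::finite) set"
  assumes "compact K" "open U" "K \<subseteq> U"
  shows "\<exists>\<kappa> L. smooth_function_on UNIV \<kappa> \<and> (\<forall>x. 0 \<le> \<kappa> x \<and> \<kappa> x \<le> 1) \<and> (\<forall>x\<in>K. \<kappa> x = 1) \<and>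
    (\<forall>x. x \<notin> U \<longrightarrow> \<kappa> x = 0) \<and> (\<forall>x y. \<bar>\<kappa> y - \<kappa> x\<bar> \<le> L * dist y x)"
proof (cases "K = {}")
  case True
  then show ?thesis
    by (intro exI[of _ "\<lambda>_. 0"] exI[of _ 0]) (auto simp: smooth_function_on_def Ck_on_const)
next
  case False
  obtain R where R: "R > 0" "\<And>y. infdist y K \<le> 2 * R \<Longrightarrow> y \<in> U"
    using compact_open_infdist[OF assms False] by blast
  \<comment> \<open>The mollified plateau may be nonzero up to distance \<open>3 * r\<close>, which
    is below \<open>2 * R\<close>.\<close>
  define r where "r = R / 2"
  have r: "r > 0" "\<And>y. infdist y K < 3 * r \<Longrightarrow> y \<in> U"
    using R by (auto simp: r_def)
  obtain \<phi> :: "real ^ 'n \<Rightarrow> real" where \<phi>: "mollifier r \<phi>"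
    using mollifier_exists[OF r(1)] by blast
  define \<kappa> where "\<kappa> = convolve (plateau K r) \<phi>"
  note near = convolve_near[OF \<phi> plateau_continuous[OF r(1)], of _ K]
  have idist: "\<bar>infdist y K - infdist x K\<bar> < r" if "dist x y < r" for x y
    using infdist_triangle_abs[of y K x] that by (simp add: dist_commute)
  have "smooth_function_on UNIV \<kappa>"
    unfolding \<kappa>_def
  proof (rule smooth_convolve[OF plateau_continuous[OF r(1)]])
    show "compact {y. infdist y K \<le> 2 * r}"
      using False assms(1) r(1) by (intro compact_infdist_le) auto
    show "plateau K r y = 0" if "y \<notin> {y. infdist y K \<le> 2 * r}" for y
      using that r(1) by (intro plateau_eq_0) auto
    show "smooth_function_on UNIV \<phi>" using \<phi> by (simp add: mollifier_def)
  qed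
  moreover have "0 \<le> \<kappa> x \<and> \<kappa> x \<le> 1" for x
  proof -
    \<comment> \<open>Centring at 1/2 gives both bounds on the average at once.\<close>
    have "\<bar>plateau K r y - 1 / 2\<bar> \<le> 1 / 2" for y
      using plateau_range[of K r y] by linarith
    then have "\<bar>\<kappa> x - 1 / 2\<bar> \<le> 1 / 2"
      unfolding \<kappa>_def by (intro near) auto
    then show ?thesis unfolding abs_le_iff by (simp add: field_simps)
  qed
  moreover have "\<kappa> x = 1" if "x \<in> K" for x
  proof -
    have "\<bar>\<kappa> x - 1\<bar> \<le> 0"
      unfolding \<kappa>_def using idist[of x] that r(1) by (intro near) (force simp: plateau_eq_1)
    then show ?thesis by simp
  qed
  moreover have "\<kappa> x = 0" if "x \<notin> U" for x
  proof -
    have "infdist x K \<ge> 3 * r" using r(2)[of x] that by linarith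
    then have "plateau K r y = 0" if "dist x y < r" for y
      using idist[OF that] r(1) by (intro plateau_eq_0) auto
    then have "\<bar>\<kappa> x - 0\<bar> \<le> 0"
      unfolding \<kappa>_def by (intro near) auto
    then show ?thesis by simp
  qed
  moreover have "\<bar>\<kappa> y - \<kappa> x\<bar> \<le> 1 / r * dist y x" for x y
  proof -
    have "\<bar>plateau K r (y - x + z) - plateau K r z\<bar> \<le> 1 / r * dist y x" for z
      using plateau_lipschitz[OF r(1), of K "y - x + z" z] by (simp add: dist_norm)
    then show ?thesis
      using convolve_translate[OF \<phi> plateau_continuous[OF r(1)], of x K "y - x"]
      by (simp add: \<kappa>_def)
  qed
  ultimately show ?thesis by blast
qed

section \<open>Smooth approximation under a slope bound\<close>

lemma slope_onD:
  "slope_on G u h \<Longrightarrow> x \<in> G \<Longrightarrow> \<epsilon> > 0 \<Longrightarrow> \<forall>\<^sub>F y in nhds x. \<bar>u y - u x\<bar> \<le> (h x + \<epsilon>) * dist y x"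
  by (simp add: slope_on_def)

lemma slope_on_continuous:
  assumes "slope_on G u h" "open G"
  shows "continuous_on G u"
proof -
  have "isCont u x" if "x \<in> G" for x
  proof -
    have ev: "\<forall>\<^sub>F y in nhds x. \<bar>u y - u x\<bar> \<le> (h x + 1) * dist y x"
      using assms(1) that zero_less_one unfolding slope_on_def by blast
    have "((\<lambda>y. (h x + 1) * dist y x) \<longlongrightarrow> (h x + 1) * dist x x) (nhds x)"
      by (intro tendsto_intros filterlim_ident)
    then have "((\<lambda>y. (h x + 1) * dist y x) \<longlongrightarrow> 0) (nhds x)" by simp
    then have "((\<lambda>y. u y - u x) \<longlongrightarrow> 0) (nhds x)"
      by (rule Lim_null_comparison[rotated]) (use ev in simp)
    then have "(u \<longlongrightarrow> u x) (nhds x)" by (simp add: LIM_zero_iff)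
    then show ?thesis by (simp add: tendsto_nhds_iff isCont_def)
  qed
  then show ?thesis by (simp add: continuous_at_imp_continuous_on)
qed

text \<open>Near a compact set a single mollification suffices. On balls of radius
  \<open>2 * \<delta>\<close> around points of \<open>K\<close> the cut-off function agrees with
  \<open>u\<close> and \<open>h\<close> stays below \<open>h x + e\<close>, so \<open>u\<close> is
  Lipschitz there with that constant, and the convolution inherits it.\<close>

lemma local_smooth_approx:
  fixes G :: "(real ^ 'n::finite) set"
  assumes G: "open G" and u: "slope_on G u h" and h: "continuous_on G h"
    and K: "compact K" "K \<subseteq> G" and e: "e > 0"
  shows "\<exists>m. smooth_function_on UNIV m \<and> (\<forall>x\<in>K. \<bar>m x - u x\<bar> \<le> e \<and>
    (\<forall>\<^sub>F y in nhds x. \<bar>m y - m x\<bar> \<le> (h x + e) * dist y x))"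
proof (cases "K = {}")
  case True
  then show ?thesis
    by (intro exI[of _ "\<lambda>_. 0"]) (auto simp: smooth_function_on_def Ck_on_const)
next
  case False
  obtain r where r: "r > 0" "\<And>y. infdist y K \<le> 2 * r \<Longrightarrow> y \<in> G"
    using compact_open_infdist[OF K(1) G K(2) False] by blast
  define K2 where "K2 = {y. infdist y K \<le> 2 * r}"
  have K2: "compact K2" "K2 \<subseteq> G"
    unfolding K2_def using r False K(1) by (auto intro!: compact_infdist_le)
  \<comment> \<open>Outside \<open>G\<close> the values of \<open>u\<close> are arbitrary. The
    plateau vanishes off the compact set \<open>K2\<close>, so the extension by 0 is
    continuous.\<close>
  define v where "v y = (if y \<in> G then plateau K r y * u y else 0)" for y
  have u_cont: "continuous_on G u" by (rule slope_on_continuous[OF u G])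
  have v_cont: "continuous_on UNIV v"
  proof -
    have "continuous_on G v"
      by (rule continuous_on_eq[of _ "\<lambda>y. plateau K r y * u y"])
        (auto simp: v_def intro!: continuous_on_mult plateau_continuous r(1) u_cont)
    moreover have "continuous_on (- K2) v"
      by (rule continuous_on_eq[of _ "\<lambda>y. 0"]) (use r(1) in \<open>auto simp: v_def K2_def plateau_eq_0\<close>)
    ultimately have "continuous_on (G \<union> - K2) v"
      using G K2(1) by (intro continuous_on_open_Un) (auto intro: compact_imp_closed)
    moreover have "G \<union> - K2 = UNIV" using K2(2) by auto
    ultimately show ?thesis by simp
  qed
  have v_eq: "v y = u y" "y \<in> K2" if "infdist y K \<le> r" for y
    using that r by (auto simp: v_def plateau_eq_1 K2_def)
  have "uniformly_continuous_on K2 h" "uniformly_continuous_on K2 u"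
    using K2 h u_cont by (auto intro: compact_uniformly_continuous continuous_on_subset)
  then obtain d1 d2 where d: "d1 > 0" "d2 > 0"
      "\<And>x y. x \<in> K2 \<Longrightarrow> y \<in> K2 \<Longrightarrow> dist y x < d1 \<Longrightarrow> dist (h y) (h x) < e"
      "\<And>x y. x \<in> K2 \<Longrightarrow> y \<in> K2 \<Longrightarrow> dist y x < d2 \<Longrightarrow> dist (u y) (u x) < e"
    using e unfolding uniformly_continuous_on_def by metis
  \<comment> \<open>Halving leaves room for points \<open>z\<close> within \<open>\<delta>\<close>
    of \<open>x\<close> together with their translates \<open>y - x + z\<close>, where
    \<open>dist y x < \<delta>\<close>: all of them lie in the ball of radius
    \<open>2 * \<delta>\<close>.\<close>
  define \<delta> where "\<delta> = min (min d1 d2) r / 2"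
  have \<delta>: "\<delta> > 0" "2 * \<delta> \<le> d1" "2 * \<delta> \<le> d2" "2 * \<delta> \<le> r"
    using d r by (auto simp: \<delta>_def)
  obtain \<phi> :: "real ^ 'n \<Rightarrow> real" where \<phi>: "mollifier \<delta> \<phi>"
    using mollifier_exists[OF \<delta>(1)] by blast
  have "smooth_function_on UNIV (convolve v \<phi>)"
  proof (rule smooth_convolve[OF v_cont K2(1)])
    show "v y = 0" if "y \<notin> K2" for y
      using that r(1) by (simp add: v_def K2_def plateau_eq_0)
    show "smooth_function_on UNIV \<phi>" using \<phi> by (simp add: mollifier_def)
  qed
  moreover have "\<bar>convolve v \<phi> x - u x\<bar> \<le> e \<and>
      (\<forall>\<^sub>F y in nhds x. \<bar>convolve v \<phi> y - convolve v \<phi> x\<bar> \<le> (h x + e) * dist y x)" if x: "x \<in> K" for x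
  proof
    have near: "infdist y K \<le> r" if "y \<in> ball x (2 * \<delta>)" for y
      using infdist_le2[OF x, of y r] that \<delta>(4) by (simp add: dist_commute)
    have xK: "x \<in> K2" using near[of x] \<delta>(1) v_eq by simp
    show "\<bar>convolve v \<phi> x - u x\<bar> \<le> e"
    proof (rule convolve_near[OF \<phi> v_cont])
      fix y assume "dist x y < \<delta>"
      then have "y \<in> ball x (2 * \<delta>)" using \<delta>(1) by auto
      then show "\<bar>v y - u x\<bar> \<le> e"
        using v_eq[OF near] d(4)[OF xK, of y] \<delta>(3) by (simp add: dist_real_def dist_commute)
    qed
    have lip: "\<bar>u z - u y\<bar> \<le> (h x + e) * dist z y" if "y \<in> ball x (2 * \<delta>)" "z \<in> ball x (2 * \<delta>)" for y z
    proof (rule slope_on_lipschitz[OF u convex_ball[of x "2 * \<delta>"] _ _ that])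
      show "ball x (2 * \<delta>) \<subseteq> G" using near v_eq(2) K2(2) by blast
      show "h w < h x + e" if "w \<in> ball x (2 * \<delta>)" for w
        using d(3)[OF xK v_eq(2)[OF near[OF that]]] that \<delta>(2) by (simp add: dist_commute dist_real_def)
    qed
    have "\<bar>convolve v \<phi> y - convolve v \<phi> x\<bar> \<le> (h x + e) * dist y x" if y: "dist y x < \<delta>" for y
    proof -
      have "\<bar>v (y - x + z) - v z\<bar> \<le> (h x + e) * dist y x" if z: "dist x z < \<delta>" for z
      proof -
        have "dist x (y - x + z) \<le> norm (x - y) + norm (x - z)"
          using norm_triangle_ineq[of "x - y" "x - z"] by (simp add: dist_norm algebra_simps)
        then have "y - x + z \<in> ball x (2 * \<delta>)" "z \<in> ball x (2 * \<delta>)"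
          using y z \<delta>(1) by (auto simp: dist_norm norm_minus_commute)
        then show ?thesis using lip[of z "y - x + z"] v_eq(1)[OF near] by (simp add: dist_norm)
      qed
      then show ?thesis
        using convolve_translate[OF \<phi> v_cont, of x "y - x" "(h x + e) * dist y x"] by simp
    qed
    then show "\<forall>\<^sub>F y in nhds x. \<bar>convolve v \<phi> y - convolve v \<phi> x\<bar> \<le> (h x + e) * dist y x"
      using \<delta>(1) by (auto simp: eventually_nhds_metric)
  qed
  ultimately show ?thesis by blast
qed

text \<open>Move from \<open>x\<close> in the direction of \<open>a\<close> itself, where the linear
  part is as large as its norm allows.\<close>

lemma norm_le_of_has_derivative:
  fixes a x :: "'a::euclidean_space" and g :: "'a \<Rightarrow> real"
  assumes "(g has_derivative (\<lambda>w. a \<bullet> w)) (at x)" "\<forall>\<^sub>F y in nhds x. \<bar>g y - g x\<bar> \<le> M * dist y x" "M \<ge> 0"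
  shows "norm a \<le> M"
proof (rule field_le_epsilon)
  fix e :: real assume "e > 0"
  then have "\<forall>\<^sub>F y in nhds x. norm (g y - g x - a \<bullet> (y - x)) \<le> e * norm (y - x)"
    using assms(1) by (auto simp: has_derivative_within_alt eventually_nhds_metric dist_norm)
  then have "\<forall>\<^sub>F y in nhds x. \<bar>a \<bullet> (y - x)\<bar> \<le> (M + e) * norm (y - x)"
    using assms(2) by eventually_elim (simp add: dist_norm distrib_right)
  then obtain d where d: "d > 0" "\<And>y. dist y x < d \<Longrightarrow> \<bar>a \<bullet> (y - x)\<bar> \<le> (M + e) * norm (y - x)"
    by (auto simp: eventually_nhds_metric)
  show "norm a \<le> M + e"
  proof (cases "a = 0")
    case False
    \<comment> \<open>Places the test point \<open>x + s *\<^sub>R a\<close> at distance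
      \<open>d / 2\<close> from \<open>x\<close>.\<close>
    define s where "s = d / 2 / norm a"
    have s: "s > 0" "s * norm a < d" using d(1) False by (auto simp: s_def)
    have "s * (norm a * norm a) \<le> s * ((M + e) * norm a)"
      using d(2)[of "x + s *\<^sub>R a"] s
      by (simp add: dist_norm dot_square_norm power2_eq_square mult.left_commute abs_mult)
    then show ?thesis using s(1) False by (simp add: mult_le_cancel_left mult_le_cancel_right)
  qed (use assms(3) \<open>e > 0\<close> in simp)
qed

text \<open>Local approximations \<open>m j\<close> on an exhaustion \<open>C\<close> are glued with
  a partition of unity \<open>\<psi>\<close>. Increments of the glued function are convex
  combinations of those of the \<open>m j\<close>, plus increments of \<open>\<psi> j\<close> times
  \<open>m j - u\<close>. The accuracy of \<open>m j\<close> is fixed after the Lipschitz constant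
  of \<open>\<psi> j\<close>, so the extra terms have a small sum.\<close>

lemma smooth_approx:
  fixes G :: "(real ^ 'n::finite) set"
  assumes G: "open G" and u: "slope_on G u h" and h: "continuous_on G h" and e: "e > 0"
  shows "\<exists>g. smooth_function_on G g \<and> (\<forall>x\<in>G. \<bar>g x - u x\<bar> \<le> e \<and> norm (gradient g x) \<le> h x + e)"
proof -
  obtain C where C: "\<And>n. compact (C n)" "\<And>n. C n \<subseteq> G" "\<And>n. C n \<subseteq> interior (C (Suc n))" "\<Union>(range C) = G"
    using open_Union_compact_subsets[OF G] by metis
  have mono: "C i \<subseteq> C j" if "i \<le> j" for i j
    using that by (induction j) (use C(3) interior_subset in \<open>fastforce simp: le_Suc_eq\<close>)+
  have "\<forall>j. \<exists>\<kappa> L. smooth_function_on UNIV \<kappa> \<and> (\<forall>x. 0 \<le> \<kappa> x \<and> \<kappa> x \<le> 1) \<and> (\<forall>x\<in>C j. \<kappa> x = 1) \<and>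
      (\<forall>x. x \<notin> interior (C (Suc j)) \<longrightarrow> \<kappa> x = 0) \<and> (\<forall>x y. \<bar>\<kappa> y - \<kappa> x\<bar> \<le> L * dist y x)"
    by (intro allI smooth_cutoff C open_interior)
  then obtain \<kappa> L where \<kappa>: "\<And>j. smooth_function_on UNIV (\<kappa> j)" "\<And>j x. 0 \<le> \<kappa> j x \<and> \<kappa> j x \<le> 1"
      "\<And>j x. x \<in> C j \<Longrightarrow> \<kappa> j x = 1" "\<And>j x. x \<notin> interior (C (Suc j)) \<Longrightarrow> \<kappa> j x = 0"
      and L: "\<And>j x y. \<bar>\<kappa> j y - \<kappa> j x\<bar> \<le> L j * dist y x"
    by metis
  \<comment> \<open>Differences of consecutive cutoffs: partial sums telescope to
    \<open>\<kappa> J\<close>, and for \<open>j > 0\<close> the function \<open>\<psi> j\<close>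
    vanishes on \<open>C (j - 1)\<close> and outside \<open>C (Suc j)\<close>.\<close>
  define \<psi> where "\<psi> j x = (case j of 0 \<Rightarrow> \<kappa> 0 x | Suc i \<Rightarrow> \<kappa> j x - \<kappa> i x)" for j x
  \<comment> \<open>A Lipschitz constant of \<open>\<psi> j\<close>; the added 1 keeps it positive,
    as it becomes a denominator.\<close>
  define M where "M j = (case j of 0 \<Rightarrow> \<bar>L 0\<bar> | Suc i \<Rightarrow> \<bar>L j\<bar> + \<bar>L i\<bar>) + 1" for j
  have M: "M j \<ge> 1" "\<bar>\<psi> j y - \<psi> j x\<bar> \<le> M j * dist y x" for j x y
  proof -
    have abs: "\<bar>\<kappa> i y - \<kappa> i x\<bar> \<le> \<bar>L i\<bar> * dist y x" for i
      using L[of i y x] mult_right_mono[OF abs_ge_self[of "L i"] zero_le_dist[of y x]] by linarith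
    show "M j \<ge> 1" by (simp add: M_def split: nat.split)
    have "\<bar>\<psi> j y - \<psi> j x\<bar> \<le> (M j - 1) * dist y x"
    proof (cases j)
      case 0
      then show ?thesis using abs[of 0] by (simp add: \<psi>_def M_def)
    next
      case (Suc i)
      then show ?thesis using abs[of i] abs[of j] by (simp add: \<psi>_def M_def distrib_right)
    qed
    also have "\<dots> \<le> M j * dist y x" by (intro mult_right_mono) auto
    finally show "\<bar>\<psi> j y - \<psi> j x\<bar> \<le> M j * dist y x" .
  qed
  have \<psi>_sm: "Ck_on k UNIV (\<psi> j)" for k j
    using smooth_function_on_Ck_on[OF \<kappa>(1)] unfolding \<psi>_def by (cases j) (auto intro!: Ck_on_diff)
  have \<psi>_out: "\<psi> j x = 0" if "x \<notin> interior (C (Suc j))" for j x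
  proof (cases j)
    case (Suc i)
    then have "x \<notin> interior (C (Suc i))"
      using that interior_mono[OF mono[of "Suc i" "Suc (Suc i)"]] by auto
    then show ?thesis using Suc that \<kappa>(4) by (simp add: \<psi>_def)
  qed (use that \<kappa>(4) in \<open>simp add: \<psi>_def\<close>)
  have \<psi>_in: "\<psi> j x = 0" if "x \<in> C i" "i < j" for i j x
  proof -
    obtain k where k: "j = Suc k" "i \<le> k" using \<open>i < j\<close> by (cases j) auto
    then have "x \<in> C k" "x \<in> C (Suc k)" using that mono[of i k] mono[of i j] by auto
    then show ?thesis using k(1) \<kappa>(3) by (simp add: \<psi>_def)
  qed
  have \<psi>_nonneg: "\<psi> j x \<ge> 0" for j x
  proof (cases j)
    case (Suc i)
    \<comment> \<open>The set \<open>C j\<close> separates the regions where the two cutoffs descend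
      from 1 to 0.\<close>
    have "\<kappa> j x = 1 \<or> \<kappa> i x = 0"
      using Suc \<kappa>(3)[of x j] \<kappa>(4)[of x i] interior_subset[of "C j"] by blast
    then show ?thesis
      using Suc \<kappa>(2)[of j x] \<kappa>(2)[of i x] by (auto simp: \<psi>_def)
  qed (simp add: \<psi>_def \<kappa>(2))
  have \<psi>_tele: "(\<Sum>j\<le>J. \<psi> j x) = \<kappa> J x" for J x
    by (induction J) (auto simp: \<psi>_def)
  \<comment> \<open>Chosen so that \<open>M j * c j\<close> is \<open>e / 4 * (1 / 2) ^ j\<close>;
    the errors due to increments of the \<open>\<psi> j\<close> then sum to at most
    \<open>e / 2\<close>.\<close>
  define c where "c j = e / 2 * (1 / 2) ^ j / (2 * M j)" for j
  have c: "c j > 0" "c j \<le> e / 2" "M j * c j = e / 4 * (1 / 2) ^ j" for j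
  proof -
    have "(1 / 2 :: real) ^ j \<le> 1" by (simp add: power_le_one)
    then have "e / 2 * (1 / 2) ^ j \<le> e / 2 * 1" using e by (intro mult_left_mono) auto
    then have "e / 2 * (1 / 2) ^ j / (2 * M j) \<le> e / 2 / 1"
      using M(1)[of j] e by (intro frac_le) auto
    then show "c j \<le> e / 2" by (simp add: c_def)
  qed (use e M(1)[of j] in \<open>auto simp: c_def field_simps\<close>)
  have "\<forall>j. \<exists>m. smooth_function_on UNIV m \<and> (\<forall>x\<in>C (Suc j). \<bar>m x - u x\<bar> \<le> c j \<and>
      (\<forall>\<^sub>F y in nhds x. \<bar>m y - m x\<bar> \<le> (h x + c j) * dist y x))"
    by (intro allI local_smooth_approx[OF G u h C(1) C(2) c(1)])
  from choice[OF this] obtain m where m: "\<forall>j. smooth_function_on UNIV (m j) \<and> (\<forall>x\<in>C (Suc j). \<bar>m j x - u x\<bar> \<le> c j \<and>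
      (\<forall>\<^sub>F y in nhds x. \<bar>m j y - m j x\<bar> \<le> (h x + c j) * dist y x))" ..
  have m_sm: "smooth_function_on UNIV (m j)" for j
    using m by simp
  have m_near: "\<bar>m j x - u x\<bar> \<le> c j" if "x \<in> C (Suc j)" for j x
    using m that by simp
  have m_lip: "\<forall>\<^sub>F y in nhds x. \<bar>m j y - m j x\<bar> \<le> (h x + c j) * dist y x" if "x \<in> C (Suc j)" for j x
    using m that by simp
  \<comment> \<open>The sum over all \<open>j\<close>, cut at the first compact set containing
    \<open>x\<close>. Later \<open>\<psi> j\<close> vanish there, so every \<open>J\<close> with
    \<open>x \<in> C J\<close> gives the same value.\<close>
  define g where "g x = (\<Sum>j\<le>(LEAST J. x \<in> C J). \<psi> j x * m j x)" for x
  have g: "g x = (\<Sum>j\<le>J. \<psi> j x * m j x)" if "x \<in> C J" for x J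
    unfolding g_def
  proof (rule sum.mono_neutral_left)
    have "x \<in> C (LEAST J. x \<in> C J)" using that by (rule LeastI)
    then show "\<forall>i\<in>{..J} - {..LEAST J. x \<in> C J}. \<psi> i x * m i x = 0" using \<psi>_in by auto
    show "{..LEAST J. x \<in> C J} \<subseteq> {..J}" using Least_le[of "\<lambda>J. x \<in> C J", OF that] by auto
  qed simp
  have inside: "\<exists>J. x \<in> interior (C J)" if "x \<in> G" for x
    using that C(3,4) by blast
  have g_sm: "Ck_on k G g" for k
  proof -
    have "Ck_on k (interior (C J)) g" for J
    proof (rule Ck_on_cong)
      show "Ck_on k (interior (C J)) (\<lambda>x. \<Sum>j\<le>J. \<psi> j x * m j x)"
        by (intro Ck_on_sum Ck_on_mult open_interior Ck_on_subset[OF \<psi>_sm subset_UNIV]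
            Ck_on_subset[OF smooth_function_on_Ck_on[OF m_sm] subset_UNIV])
      show "(\<Sum>j\<le>J. \<psi> j x * m j x) = g x" if "x \<in> interior (C J)" for x
        using g[of x J] that interior_subset[of "C J"] by auto
    qed simp
    then have "Ck_on k (\<Union>J. interior (C J)) g" by (intro Ck_on_UN) auto
    then show ?thesis
      by (rule Ck_on_subset) (use inside in auto)
  qed
  have "\<bar>g x - u x\<bar> \<le> e \<and> norm (gradient g x) \<le> h x + e" if x: "x \<in> G" for x
  proof
    obtain J where J: "x \<in> interior (C J)" using inside[OF x] by blast
    then have xJ: "x \<in> C J" using interior_subset[of "C J"] by blast
    have one: "(\<Sum>j\<le>J. \<psi> j y) = 1" if "y \<in> C J" for y
      using \<psi>_tele \<kappa>(3)[OF that] by simp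
    \<comment> \<open>One half of \<open>e\<close> pays for the slopes of the \<open>m j\<close>,
      the other for the increments of the \<open>\<psi> j\<close>.\<close>
    define H where "H = h x + e / 2"
    \<comment> \<open>No point of the space is isolated, so the slope inequality at some
      \<open>y\<close> other than \<open>x\<close> forces the sign.\<close>
    have h0: "H \<ge> 0"
      unfolding H_def
    proof -
      have ev: "\<forall>\<^sub>F y in at x. \<bar>u y - u x\<bar> \<le> (h x + e / 2) * dist y x"
        using slope_onD[OF u x, of "e / 2"] e unfolding eventually_at_filter by (auto elim: eventually_mono)
      have "\<forall>\<^sub>F y in at x. y \<noteq> x" by (simp add: eventually_at_filter)
      with ev have "\<forall>\<^sub>F y in at x. 0 \<le> h x + e / 2"
      proof eventually_elim
        case (elim y)
        then have "0 \<le> (h x + e / 2) * dist y x" "dist y x > 0" by auto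
        then show ?case by (simp add: zero_le_mult_iff)
      qed
      then show "0 \<le> h x + e / 2" by simp
    qed
    have diff: "\<bar>\<psi> j x * (m j x - u x)\<bar> \<le> \<psi> j x * e" for j
    proof (cases "x \<in> C (Suc j)")
      case True
      then show ?thesis
        using m_near[OF True] c(2)[of j] \<psi>_nonneg[of j x] e
        by (auto simp: abs_mult intro!: mult_left_mono)
    next
      case False
      then have "\<psi> j x = 0" using \<psi>_out interior_subset[of "C (Suc j)"] by blast
      then show ?thesis by simp
    qed
    have "g x - u x = (\<Sum>j\<le>J. \<psi> j x * (m j x - u x))"
      using g[OF xJ] one[OF xJ] by (simp add: right_diff_distrib sum_subtractf sum_distrib_right[symmetric])
    also have "\<bar>\<dots>\<bar> \<le> (\<Sum>j\<le>J. \<psi> j x * e)"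
      using diff by (intro order_trans[OF sum_abs] sum_mono)
    also have "\<dots> = e" using one[OF xJ] by (simp add: sum_distrib_right[symmetric])
    finally show "\<bar>g x - u x\<bar> \<le> e" .
    have loc: "\<forall>\<^sub>F y in nhds x. \<bar>\<psi> j y * (m j y - m j x) + (\<psi> j y - \<psi> j x) * (m j x - u x)\<bar>
        \<le> (\<psi> j y * H + e / 4 * (1 / 2) ^ j) * dist y x" for j
    proof (cases "x \<in> C (Suc j)")
      case True
      show ?thesis
        using m_lip[OF True]
      proof eventually_elim
        case (elim y)
        have lip: "\<bar>m j y - m j x\<bar> \<le> H * dist y x"
          using c(2)[of j] by (intro order_trans[OF elim] mult_right_mono) (auto simp: H_def)
        have "\<bar>\<psi> j y * (m j y - m j x) + (\<psi> j y - \<psi> j x) * (m j x - u x)\<bar>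
            \<le> \<psi> j y * \<bar>m j y - m j x\<bar> + \<bar>\<psi> j y - \<psi> j x\<bar> * \<bar>m j x - u x\<bar>"
          using abs_triangle_ineq[of "\<psi> j y * (m j y - m j x)" "(\<psi> j y - \<psi> j x) * (m j x - u x)"] \<psi>_nonneg[of j y]
          by (simp add: abs_mult)
        also have "\<dots> \<le> \<psi> j y * (H * dist y x) + (M j * dist y x) * c j"
        proof (rule add_mono)
          show "\<psi> j y * \<bar>m j y - m j x\<bar> \<le> \<psi> j y * (H * dist y x)"
            using lip \<psi>_nonneg by (intro mult_left_mono)
          show "\<bar>\<psi> j y - \<psi> j x\<bar> * \<bar>m j x - u x\<bar> \<le> (M j * dist y x) * c j"
            using M(1)[of j] by (intro mult_mono M(2) m_near[OF True]) auto
        qed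
        also have "(M j * dist y x) * c j = e / 4 * (1 / 2) ^ j * dist y x"
          using c(3)[of j] by (simp add: mult_ac)
        also have "\<psi> j y * (H * dist y x) + e / 4 * (1 / 2) ^ j * dist y x
            = (\<psi> j y * H + e / 4 * (1 / 2) ^ j) * dist y x"
          by (simp add: distrib_right mult.assoc)
        finally show ?case .
      qed
    next
      case False
      then have "\<forall>\<^sub>F y in nhds x. y \<notin> C (Suc j)"
        using eventually_nhds_in_open[of "- C (Suc j)" x] C(1)[THEN compact_imp_closed, of "Suc j"]
        by (simp add: open_Compl)
      then show ?thesis
      proof eventually_elim
        case (elim y)
        then have "\<psi> j y = 0" "\<psi> j x = 0"
          using \<psi>_out False interior_subset[of "C (Suc j)"] by blast+
        then show ?case using e by simp
      qed
    qed
    have "\<forall>\<^sub>F y in nhds x. \<forall>j\<in>{..J}. \<bar>\<psi> j y * (m j y - m j x) + (\<psi> j y - \<psi> j x) * (m j x - u x)\<bar>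
        \<le> (\<psi> j y * H + e / 4 * (1 / 2) ^ j) * dist y x"
      using loc by (intro eventually_ball_finite) auto
    moreover have "\<forall>\<^sub>F y in nhds x. y \<in> interior (C J)"
      using J by (intro eventually_nhds_in_open) auto
    ultimately have ev: "\<forall>\<^sub>F y in nhds x. \<bar>g y - g x\<bar> \<le> (h x + e) * dist y x"
    proof eventually_elim
      case (elim y)
      then have yJ: "y \<in> C J" using interior_subset[of "C J"] by blast
      \<comment> \<open>The subtracted bracket is 0, as the \<open>\<psi> j\<close> sum to 1 at both
        points; it brings in the small differences \<open>m j x - u x\<close>.\<close>
      have "g y - g x = (\<Sum>j\<le>J. \<psi> j y * m j y - \<psi> j x * m j x) - ((\<Sum>j\<le>J. \<psi> j y) - (\<Sum>j\<le>J. \<psi> j x)) * u x"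
        using g[OF xJ] g[OF yJ] one[OF xJ] one[OF yJ] by (simp add: sum_subtractf)
      also have "\<dots> = (\<Sum>j\<le>J. \<psi> j y * (m j y - m j x) + (\<psi> j y - \<psi> j x) * (m j x - u x))"
        unfolding sum_subtractf[symmetric] sum_distrib_right by (intro sum.cong refl) (simp add: algebra_simps)
      also have "\<bar>\<dots>\<bar> \<le> (\<Sum>j\<le>J. (\<psi> j y * H + e / 4 * (1 / 2) ^ j) * dist y x)"
        using elim(1) by (intro order_trans[OF sum_abs] sum_mono) auto
      also have "\<dots> = ((\<Sum>j\<le>J. \<psi> j y) * H + e / 4 * (\<Sum>j\<le>J. (1 / 2) ^ j)) * dist y x"
        by (simp only: sum.distrib sum_distrib_right sum_distrib_left distrib_right)
      also have "\<dots> \<le> (h x + e) * dist y x"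
      proof (rule mult_right_mono)
        have "(\<Sum>j\<le>J. (1 / 2 :: real) ^ j) \<le> 2"
          using sum_gp[of "1/2::real" 0 J] by (simp add: atMost_atLeast0)
        then have "e / 4 * (\<Sum>j\<le>J. (1 / 2) ^ j) \<le> e / 4 * 2"
          using e by (intro mult_left_mono) auto
        then show "(\<Sum>j\<le>J. \<psi> j y) * H + e / 4 * (\<Sum>j\<le>J. (1 / 2) ^ j) \<le> h x + e"
          using one[OF yJ] by (simp add: H_def)
      qed simp
      finally show ?case .
    qed
    have "g differentiable at x"
      using g_sm[of 1] G x by (simp add: differentiable_on_eq_differentiable_at)
    from has_derivative_gradient[OF this] show "norm (gradient g x) \<le> h x + e"
      by (rule norm_le_of_has_derivative) (use ev h0 e in \<open>auto simp: H_def\<close>)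
  qed
  then show ?thesis using g_sm by (auto simp: smooth_function_on_def)
qed

section \<open>Moment inequalities\<close>

lemma powr_diff_le:
  fixes a b q :: real
  assumes "a \<ge> 0" "b \<ge> 0" "q > 1"
  shows "\<bar>a powr q - b powr q\<bar> \<le> q * max a b powr (q - 1) * \<bar>a - b\<bar>"
  using assms(1,2)
proof (induction a b rule: linorder_wlog)
  case (le a b)
  show ?case
  proof (cases "a = b")
    case False
    then have "a < b" using le by simp
    moreover have "continuous_on {a..b} (\<lambda>z. z powr q)"
      using le assms by (intro continuous_on_powr' continuous_intros) auto
    moreover have D: "((\<lambda>z. z powr q) has_real_derivative q * z powr (q - 1)) (at z)" if "a < z" for z
      using that le by (intro has_real_derivative_powr) auto
    ultimately obtain l z where z: "a < z" "z < b" "((\<lambda>z. z powr q) has_real_derivative l) (at z)"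
        "b powr q - a powr q = (b - a) * l"
      using MVT[of a b "\<lambda>z. z powr q"] by (metis real_differentiable_def)
    have "l = q * z powr (q - 1)" using DERIV_unique[OF z(3) D[OF z(1)]] .
    moreover have "z powr (q - 1) \<le> b powr (q - 1)"
      using z le assms by (intro powr_mono2) auto
    ultimately have "b powr q - a powr q \<le> (b - a) * (q * b powr (q - 1))"
      using z le assms by (auto intro!: mult_left_mono)
    moreover have "a powr q \<le> b powr q" using le assms by (intro powr_mono2) auto
    ultimately show ?thesis using le by (simp add: max_def mult_ac)
  qed simp
next
  case (sym a b)
  then show ?case by (simp add: max.commute abs_minus_commute)
qed

text \<open>The maps \<open>F\<close> used below are truncations and the absolute value, none of
  which enlarges increments.\<close>

lemma slope_on_compose_lipschitz:
  assumes "slope_on G u h" "\<And>a b. \<bar>F a - F b\<bar> \<le> \<bar>a - b :: real\<bar>"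
  shows "slope_on G (\<lambda>x. F (u x)) h"
  unfolding slope_on_def
proof (intro ballI allI impI)
  fix x and \<epsilon> :: real assume "x \<in> G" "\<epsilon> > 0"
  from slope_onD[OF assms(1) this] show "\<forall>\<^sub>F y in nhds x. \<bar>F (u y) - F (u x)\<bar> \<le> (h x + \<epsilon>) * dist y x"
    by (rule eventually_mono) (use assms(2) order_trans in blast)
qed

text \<open>Chain rule for slopes: by \<open>powr_diff_le\<close> the difference quotient of the
  power is at most \<open>q * max (u y) (u x) powr (q - 1)\<close> times that of \<open>u\<close>,
  and the first factor tends to its value at \<open>x\<close>.\<close>

lemma slope_on_powr:
  assumes u: "slope_on G u h" "open G" and nonneg: "\<And>x. x \<in> G \<Longrightarrow> u x \<ge> 0" "\<And>x. x \<in> G \<Longrightarrow> h x \<ge> 0"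
    and q: "q > 1"
  shows "slope_on G (\<lambda>x. u x powr q) (\<lambda>x. q * u x powr (q - 1) * h x)"
  unfolding slope_on_def
proof (intro ballI allI impI)
  fix x and \<epsilon> :: real assume x: "x \<in> G" and "\<epsilon> > 0"
  define k where "k = q * u x powr (q - 1)"
  have k0: "k \<ge> 0" using q by (simp add: k_def)
  \<comment> \<open>One perturbation \<open>\<eta>\<close> serves both factors, with their product
    still below \<open>k * h x + \<epsilon>\<close>.\<close>
  have "((\<lambda>\<eta>. (k + \<eta>) * (h x + \<eta>)) \<longlongrightarrow> (k + 0) * (h x + 0)) (at_right 0)"
    by (intro tendsto_intros)
  then have "\<forall>\<^sub>F \<eta> in at_right 0. (k + \<eta>) * (h x + \<eta>) < k * h x + \<epsilon>"
    using \<open>\<epsilon> > 0\<close> by (intro order_tendstoD(2)) auto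
  moreover have "\<forall>\<^sub>F \<eta> in at_right (0::real). \<eta> > 0"
    by (simp add: eventually_at_right_less)
  ultimately have "\<forall>\<^sub>F \<eta> in at_right 0. \<eta> > 0 \<and> (k + \<eta>) * (h x + \<eta>) < k * h x + \<epsilon>"
    by eventually_elim simp
  then obtain \<eta> where \<eta>: "\<eta> > 0" "(k + \<eta>) * (h x + \<eta>) < k * h x + \<epsilon>"
    using eventually_happens'[OF trivial_limit_at_right_real] by blast
  have "isCont u x"
    using slope_on_continuous[OF u] u(2) x by (simp add: continuous_on_eq_continuous_at)
  then have "(u \<longlongrightarrow> u x) (nhds x)" by (simp add: tendsto_nhds_iff isCont_def)
  then have "((\<lambda>y. q * max (u y) (u x) powr (q - 1)) \<longlongrightarrow> q * max (u x) (u x) powr (q - 1)) (nhds x)"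
    using q nonneg(1)[OF x] by (intro tendsto_intros tendsto_powr2 tendsto_max) (auto simp: max_def)
  then have "\<forall>\<^sub>F y in nhds x. q * max (u y) (u x) powr (q - 1) < k + \<eta>"
    using \<eta>(1) by (intro order_tendstoD(2)) (auto simp: k_def)
  moreover have "\<forall>\<^sub>F y in nhds x. y \<in> G"
    using u(2) x by (rule eventually_nhds_in_open)
  ultimately show "\<forall>\<^sub>F y in nhds x. \<bar>u y powr q - u x powr q\<bar> \<le> (q * u x powr (q - 1) * h x + \<epsilon>) * dist y x"
    using slope_onD[OF u(1) x \<eta>(1)]
  proof eventually_elim
    case (elim y)
    have "\<bar>u y powr q - u x powr q\<bar> \<le> q * max (u y) (u x) powr (q - 1) * \<bar>u y - u x\<bar>"
      using elim x nonneg(1) q by (intro powr_diff_le) auto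
    also have "\<dots> \<le> (k + \<eta>) * ((h x + \<eta>) * dist y x)"
      using elim k0 \<eta>(1) q by (intro mult_mono) auto
    also have "\<dots> = ((k + \<eta>) * (h x + \<eta>)) * dist y x" by simp
    also have "\<dots> \<le> (k * h x + \<epsilon>) * dist y x"
      using \<eta>(2) by (intro mult_right_mono) auto
    finally show ?case by (simp add: k_def)
  qed
qed

section \<open>Hoelder's inequality, truncation and L^p norms\<close>

lemma Hoelder_powr:
  fixes f g :: "'a \<Rightarrow> real"
  assumes f: "integrable M f" "\<And>x. f x \<ge> 0" and g: "integrable M g" "\<And>x. g x \<ge> 0"
    and \<theta>: "0 < \<theta>" "\<theta> < 1"
  shows "integrable M (\<lambda>x. f x powr \<theta> * g x powr (1 - \<theta>))"
    and "(\<integral>x. f x powr \<theta> * g x powr (1 - \<theta>) \<partial>M) \<le> (\<integral>x. f x \<partial>M) powr \<theta> * (\<integral>x. g x \<partial>M) powr (1 - \<theta>)"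
proof -
  \<comment> \<open>Weighted arithmetic-geometric mean inequality. Applied to the functions divided
    by their integrals, it gives Hoelder's inequality with exponents 1/theta and 1/(1 -
    theta).\<close>
  have young: "a powr \<theta> * b powr (1 - \<theta>) \<le> \<theta> * a + (1 - \<theta>) * b" if "a \<ge> 0" "b \<ge> 0" for a b :: real
    using Youngs_inequality_0[of \<theta> "1 - \<theta>" a b] that \<theta> by (cases "a = 0 \<or> b = 0") auto
  have [measurable]: "f \<in> borel_measurable M" "g \<in> borel_measurable M"
    using f g by auto
  show int: "integrable M (\<lambda>x. f x powr \<theta> * g x powr (1 - \<theta>))"
  proof (rule Bochner_Integration.integrable_bound)
    show "integrable M (\<lambda>x. \<theta> * f x + (1 - \<theta>) * g x)" using f g by simp
    show "AE x in M. norm (f x powr \<theta> * g x powr (1 - \<theta>)) \<le> norm (\<theta> * f x + (1 - \<theta>) * g x)"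
      using young f g \<theta> by (auto simp: abs_mult intro!: AE_I2 order_trans[OF young])
  qed measurable
  define a b where "a = (\<integral>x. f x \<partial>M)" and "b = (\<integral>x. g x \<partial>M)"
  have ab: "a \<ge> 0" "b \<ge> 0" using f g by (auto simp: a_def b_def)
  show "(\<integral>x. f x powr \<theta> * g x powr (1 - \<theta>) \<partial>M) \<le> a powr \<theta> * b powr (1 - \<theta>)"
  proof (cases "a = 0 \<or> b = 0")
    case True
    then have "(AE x in M. f x = 0) \<or> (AE x in M. g x = 0)"
      using integral_nonneg_eq_0_iff_AE[OF f(1)] integral_nonneg_eq_0_iff_AE[OF g(1)] f(2) g(2)
      by (auto simp: a_def b_def)
    then have "AE x in M. f x powr \<theta> * g x powr (1 - \<theta>) = 0"
      by (auto elim: eventually_mono)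
    then have "(\<integral>x. f x powr \<theta> * g x powr (1 - \<theta>) \<partial>M) = 0"
      using integral_eq_zero_AE by fast
    then show ?thesis by simp
  next
    case False
    then have pos: "a > 0" "b > 0" using ab by auto
    let ?c = "a powr \<theta> * b powr (1 - \<theta>)"
    have "(\<integral>x. f x powr \<theta> * g x powr (1 - \<theta>) \<partial>M) \<le> (\<integral>x. ?c * (\<theta> * (f x / a) + (1 - \<theta>) * (g x / b)) \<partial>M)"
    proof (rule integral_mono)
      show "f x powr \<theta> * g x powr (1 - \<theta>) \<le> ?c * (\<theta> * (f x / a) + (1 - \<theta>) * (g x / b))" for x
      proof -
        have "f x powr \<theta> * g x powr (1 - \<theta>) = ?c * ((f x / a) powr \<theta> * (g x / b) powr (1 - \<theta>))"
          using pos f g by (simp add: powr_divide)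
        also have "\<dots> \<le> ?c * (\<theta> * (f x / a) + (1 - \<theta>) * (g x / b))"
          using pos f g by (intro mult_left_mono young) auto
        finally show ?thesis .
      qed
    qed (use int f g in auto)
    also have "\<dots> = ?c * (\<theta> * (a / a) + (1 - \<theta>) * (b / b))"
      using f g by (simp add: a_def b_def)
    also have "\<dots> = ?c" using pos by simp
    finally show ?thesis .
  qed
qed

text \<open>Monotone convergence. Integrability is part of the conclusion because the integral of a
  function that is not integrable is 0 by default, so a bound alone would say little.\<close>

lemma integrable_of_truncations:
  fixes u :: "'a \<Rightarrow> real"
  assumes [measurable]: "u \<in> borel_measurable M" and nonneg: "\<And>x. x \<in> space M \<Longrightarrow> u x \<ge> 0" and q: "q > 0"
    and fin: "\<And>N::nat. integrable M (\<lambda>x. min (u x) N powr q)"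
    and bound: "\<And>N::nat. (\<integral>x. min (u x) N powr q \<partial>M) \<le> C"
  shows "integrable M (\<lambda>x. u x powr q) \<and> (\<integral>x. u x powr q \<partial>M) \<le> C"
proof -
  have mono: "min (u x) (real m) powr q \<le> min (u x) (real n) powr q" if "m \<le> n" "x \<in> space M" for m n x
    using that nonneg[of x] q by (intro powr_mono2) auto
  have "incseq (\<lambda>N::nat. \<integral>x. min (u x) N powr q \<partial>M)"
    using fin by (intro incseq_def[THEN iffD2] allI impI integral_mono mono)
  then obtain l where l: "(\<lambda>N::nat. \<integral>x. min (u x) N powr q \<partial>M) \<longlonglongrightarrow> l"
    using incseq_convergent[of _ C] bound by blast
  have lim: "(\<lambda>N::nat. min (u x) N powr q) \<longlonglongrightarrow> u x powr q" for x
  proof (rule tendsto_eventually)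
    have "\<forall>\<^sub>F N in sequentially. nat \<lceil>u x\<rceil> \<le> N" by (rule eventually_ge_at_top)
    then show "\<forall>\<^sub>F N in sequentially. min (u x) (real N) powr q = u x powr q"
      by eventually_elim (simp add: min_def nat_le_iff ceiling_le_iff)
  qed
  have "integrable M (\<lambda>x. u x powr q)" "(\<integral>x. u x powr q \<partial>M) = l"
    by (rule integral_monotone_convergence_nonneg[OF fin _ _ _ l];
        auto intro!: AE_I2 monoI mono lim)+
  then show ?thesis using LIMSEQ_le_const2[OF l] bound by auto
qed

text \<open>Real-valued, hence 0 if the power of \<open>u\<close> is not integrable. Bounds on it
  are therefore accompanied by integrability claims.\<close>

definition lp_norm :: "'a measure \<Rightarrow> real \<Rightarrow> ('a \<Rightarrow> real) \<Rightarrow> real" where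
  "lp_norm M p u = (\<integral>x. u x powr p \<partial>M) powr (1 / p)"

lemma lp_norm_nonneg: "lp_norm M p u \<ge> 0"
  by (simp add: lp_norm_def)

lemma lp_norm_powr:
  assumes "p > 0" "r > 0"
  shows "lp_norm M p u powr r = (\<integral>x. u x powr p \<partial>M) powr (r / p)"
  by (simp add: lp_norm_def powr_powr)

lemma lp_norm_powr_self: "p > 0 \<Longrightarrow> lp_norm M p u powr p = (\<integral>x. u x powr p \<partial>M)"
  by (simp add: lp_norm_def powr_powr)

lemma powr_two: "x powr 2 = (x::real)\<^sup>2" if "x \<ge> 0"
  using that by simp

text \<open>Hoelder's inequality against the constant 1, with weight \<open>p / r\<close>, on a
  space of total mass 1.\<close>

lemma (in prob_space) lp_norm_mono:
  assumes "0 < p" "p \<le> r" "integrable M (\<lambda>x. u x powr r)"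
  shows "integrable M (\<lambda>x. u x powr p)" and "lp_norm M p u \<le> lp_norm M r u"
proof -
  have "integrable M (\<lambda>x. u x powr p) \<and> lp_norm M p u \<le> lp_norm M r u"
  proof (cases "p = r")
    case False
    then have "p < r" "0 < p / r" "p / r < 1" using assms by auto
    have eq: "(\<lambda>x. (u x powr r) powr (p / r) * 1 powr (1 - p / r)) = (\<lambda>x. u x powr p)"
      using assms by (simp add: powr_powr)
    have int: "integrable M (\<lambda>x. u x powr p)"
      and le: "(\<integral>x. u x powr p \<partial>M) \<le> (\<integral>x. u x powr r \<partial>M) powr (p / r)"
      using Hoelder_powr[OF assms(3) _ integrable_const[of 1] _ \<open>0 < p / r\<close> \<open>p / r < 1\<close>]
      unfolding eq by (auto simp: prob_space)
    have "lp_norm M p u \<le> ((\<integral>x. u x powr r \<partial>M) powr (p / r)) powr (1 / p)"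
      unfolding lp_norm_def using assms by (intro powr_mono2 le) auto
    also have "\<dots> = lp_norm M r u"
      using assms by (simp add: lp_norm_def powr_powr)
    finally show ?thesis using int by simp
  qed (use assms in simp)
  then show "integrable M (\<lambda>x. u x powr p)" "lp_norm M p u \<le> lp_norm M r u" by auto
qed

section \<open>The Poincare-type inequality for slopes\<close>

locale poincare_space = prob_space \<mu> for \<mu> :: "(real ^ 'n::finite) measure" +
  fixes G :: "(real ^ 'n) set" and \<sigma> :: real
  assumes open_G: "open G" and sets_\<mu>: "sets \<mu> = sets (restrict_space borel G)"
    and \<sigma>_pos: "\<sigma> > 0" and poincare: "poincare_type G \<mu> (\<sigma>\<^sup>2)"
begin

lemma space_\<mu>: "space \<mu> = G"
  using sets_eq_imp_space_eq[OF sets_\<mu>] by (simp add: space_restrict_space)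

lemma measurable_continuous:
  fixes u :: "real ^ 'n \<Rightarrow> real"
  assumes "continuous_on G u"
  shows "u \<in> borel_measurable \<mu>"
  using borel_measurable_continuous_on_restrict[OF assms] measurable_cong_sets[OF sets_\<mu> refl] by blast

lemma integrable_bounded:
  fixes u :: "real ^ 'n \<Rightarrow> real"
  assumes "continuous_on G u" "\<And>x. x \<in> G \<Longrightarrow> \<bar>u x\<bar> \<le> B"
  shows "integrable \<mu> u"
  using assms by (intro integrable_const_bound[of _ B] measurable_continuous) (auto simp: space_\<mu> intro!: AE_I2)

text \<open>The inequality is applied to a smooth \<open>g\<close> within \<open>e\<close> of
  \<open>u\<close> whose gradient is at most \<open>h + e\<close>; all errors vanish as
  \<open>e\<close> tends to 0.\<close>

lemma poincare_slope:
  assumes u: "slope_on G u h" "\<And>x. x \<in> G \<Longrightarrow> \<bar>u x\<bar> \<le> B" and h: "continuous_on G h"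
    and int: "integrable \<mu> (\<lambda>x. (h x)\<^sup>2)"
  shows "(\<integral>x. (u x)\<^sup>2 \<partial>\<mu>) - (\<integral>x. u x \<partial>\<mu>)\<^sup>2 \<le> \<sigma>\<^sup>2 * (\<integral>x. (h x)\<^sup>2 \<partial>\<mu>)"
proof -
  have h1: "integrable \<mu> h"
    by (rule square_integrable_imp_integrable[OF measurable_continuous[OF h] int])
  have u_cont: "continuous_on G u" by (rule slope_on_continuous[OF u(1) open_G])
  have B0: "B \<ge> 0"
    using u(2) not_empty unfolding space_\<mu> by (meson abs_ge_zero ex_in_conv order_trans)
  \<comment> \<open>Collects the errors: the expansion of the square of \<open>h x + e\<close>, and
    \<open>e * (2 * B + 1)\<close> twice, once for the second moment and once for the squared mean.
    The factor \<open>2 * B + 1\<close> comes from the bounds \<open>B\<close> for \<open>u\<close>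
    and \<open>B + 1\<close> for \<open>g\<close>.\<close>
  let ?R = "\<lambda>e. \<sigma>\<^sup>2 * ((\<integral>x. (h x)\<^sup>2 \<partial>\<mu>) + 2 * e * (\<integral>x. h x \<partial>\<mu>) + e\<^sup>2) + 2 * (e * (2 * B + 1))"
  have "(\<integral>x. (u x)\<^sup>2 \<partial>\<mu>) - (\<integral>x. u x \<partial>\<mu>)\<^sup>2 \<le> ?R e" if e: "0 < e" "e \<le> 1" for e
  proof -
    obtain g where g: "smooth_function_on G g" "\<And>x. x \<in> G \<Longrightarrow> \<bar>g x - u x\<bar> \<le> e"
        "\<And>x. x \<in> G \<Longrightarrow> norm (gradient g x) \<le> h x + e"
      using smooth_approx[OF open_G u(1) h e(1)] by blast
    have gB: "\<bar>g x\<bar> \<le> B + 1" if "x \<in> G" for x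
      using g(2)[OF that] u(2)[OF that] e by linarith
    have g_cont: "continuous_on G g"
      using smooth_function_on_Ck_on[OF g(1)] by (rule Ck_on_continuous)
    have int_g: "integrable \<mu> g" "integrable \<mu> u"
      by (rule integrable_bounded[OF g_cont gB] integrable_bounded[OF u_cont u(2)], assumption)+
    have int_g2: "integrable \<mu> (\<lambda>x. (g x)\<^sup>2)" "integrable \<mu> (\<lambda>x. (u x)\<^sup>2)"
      using integrable_bounded[of "\<lambda>x. (g x)\<^sup>2" "(B + 1)\<^sup>2"] integrable_bounded[of "\<lambda>x. (u x)\<^sup>2" "B\<^sup>2"]
        gB u(2) g_cont u_cont abs_le_square_iff[of "g _" "B + 1"] abs_le_square_iff[of "u _" B] B0
      by (auto intro!: continuous_on_power)
    have sq: "(h x + e)\<^sup>2 = (h x)\<^sup>2 + 2 * e * h x + e\<^sup>2" for x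
      by (simp add: power2_sum)
    have int_he: "integrable \<mu> (\<lambda>x. (h x + e)\<^sup>2)"
      unfolding sq using int h1 by simp
    have he: "(\<integral>x. (h x + e)\<^sup>2 \<partial>\<mu>) = (\<integral>x. (h x)\<^sup>2 \<partial>\<mu>) + 2 * e * (\<integral>x. h x \<partial>\<mu>) + e\<^sup>2"
      unfolding sq using int h1 by (simp add: prob_space)
    have "bounded (g ` G)"
      using gB by (auto simp: bounded_iff)
    then have "ennreal ((\<integral>x. (g x)\<^sup>2 \<partial>\<mu>) - (\<integral>x. g x \<partial>\<mu>)\<^sup>2)
        \<le> ennreal (\<sigma>\<^sup>2) * (\<integral>\<^sup>+x. ennreal ((norm (gradient g x))\<^sup>2) \<partial>\<mu>)"
      using poincare g(1) unfolding poincare_type_def by blast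
    also have "(\<integral>\<^sup>+x. ennreal ((norm (gradient g x))\<^sup>2) \<partial>\<mu>) \<le> (\<integral>\<^sup>+x. ennreal ((h x + e)\<^sup>2) \<partial>\<mu>)"
      using g(3) by (intro nn_integral_mono ennreal_leI power_mono) (auto simp: space_\<mu>)
    also have "\<dots> = ennreal (\<integral>x. (h x + e)\<^sup>2 \<partial>\<mu>)"
      using int_he by (intro nn_integral_eq_integral) auto
    finally have "ennreal ((\<integral>x. (g x)\<^sup>2 \<partial>\<mu>) - (\<integral>x. g x \<partial>\<mu>)\<^sup>2) \<le> ennreal (\<sigma>\<^sup>2 * (\<integral>x. (h x + e)\<^sup>2 \<partial>\<mu>))"
      by (simp add: ennreal_mult' mult_left_mono)
    then have A: "(\<integral>x. (g x)\<^sup>2 \<partial>\<mu>) - (\<integral>x. g x \<partial>\<mu>)\<^sup>2 \<le> \<sigma>\<^sup>2 * (\<integral>x. (h x + e)\<^sup>2 \<partial>\<mu>)"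
      by (simp add: ennreal_le_iff)
    have "(\<integral>x. (u x)\<^sup>2 - (g x)\<^sup>2 \<partial>\<mu>) \<le> (\<integral>x. e * (2 * B + 1) \<partial>\<mu>)"
    proof (rule integral_mono)
      fix x assume "x \<in> space \<mu>"
      then have x: "x \<in> G" by (simp add: space_\<mu>)
      have "(u x)\<^sup>2 - (g x)\<^sup>2 = (u x - g x) * (u x + g x)" by (simp add: power2_eq_square algebra_simps)
      also have "\<dots> \<le> \<bar>u x - g x\<bar> * \<bar>u x + g x\<bar>" by (simp add: abs_mult[symmetric])
      also have "\<dots> \<le> e * (2 * B + 1)"
        using g(2)[OF x] u(2)[OF x] gB[OF x] e by (intro mult_mono) auto
      finally show "(u x)\<^sup>2 - (g x)\<^sup>2 \<le> e * (2 * B + 1)" .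
    qed (use int_g2 in auto)
    then have I2: "(\<integral>x. (u x)\<^sup>2 \<partial>\<mu>) - (\<integral>x. (g x)\<^sup>2 \<partial>\<mu>) \<le> e * (2 * B + 1)"
      using int_g2 by (simp add: prob_space)
    have bound: "\<bar>\<integral>x. v x \<partial>\<mu>\<bar> \<le> b" if "integrable \<mu> v" "\<And>x. x \<in> G \<Longrightarrow> \<bar>v x\<bar> \<le> b" for v :: "real ^ 'n \<Rightarrow> real" and b
    proof -
      have "\<bar>\<integral>x. v x \<partial>\<mu>\<bar> \<le> (\<integral>x. \<bar>v x\<bar> \<partial>\<mu>)"
        using Bochner_Integration.integral_norm_bound[of \<mu> v] by simp
      also have "\<dots> \<le> (\<integral>x. b \<partial>\<mu>)" using that by (intro integral_mono) (auto simp: space_\<mu>)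
      finally show ?thesis by (simp add: prob_space)
    qed
    let ?U = "\<integral>x. u x \<partial>\<mu>" and ?V = "\<integral>x. g x \<partial>\<mu>"
    have UV: "\<bar>?V - ?U\<bar> \<le> e"
      using bound[of "\<lambda>x. g x - u x" e] int_g g(2) by simp
    have "?V\<^sup>2 - ?U\<^sup>2 = (?V - ?U) * (?V + ?U)" by (simp add: power2_eq_square algebra_simps)
    also have "\<dots> \<le> \<bar>?V - ?U\<bar> * \<bar>?V + ?U\<bar>" by (simp add: abs_mult[symmetric])
    also have "\<dots> \<le> e * (2 * B + 1)"
      using UV bound[OF int_g(1) gB] bound[OF int_g(2) u(2)] e by (intro mult_mono) auto
    finally show ?thesis using A I2 unfolding he by simp
  qed
  then have "\<forall>\<^sub>F e in at_right 0. (\<integral>x. (u x)\<^sup>2 \<partial>\<mu>) - (\<integral>x. u x \<partial>\<mu>)\<^sup>2 \<le> ?R e"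
    by (auto simp: eventually_at_right_field intro!: exI[of _ 1])
  moreover have "(?R \<longlongrightarrow> ?R 0) (at_right 0)"
    by (intro tendsto_intros)
  ultimately have "(\<integral>x. (u x)\<^sup>2 \<partial>\<mu>) - (\<integral>x. u x \<partial>\<mu>)\<^sup>2 \<le> ?R 0"
    by (intro tendsto_lowerbound) auto
  then show ?thesis by simp
qed

text \<open>The inequality for u^(p/2), with slope (p/2) u^(p/2-1) h, produces the constant p^2/4.
  Hoelder's inequality separates u^(p-2) from h^2, and the power p-2 of the p-norm of u is
  cancelled.\<close>

lemma moment_halving:
  assumes u: "slope_on G u h" "\<And>x. 0 \<le> u x" "\<And>x. u x \<le> B" and h: "continuous_on G h" "\<And>x. 0 \<le> h x"
    and p: "p > 2" and int: "integrable \<mu> (\<lambda>x. h x powr p)"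
  shows "(lp_norm \<mu> p u)\<^sup>2 \<le> (lp_norm \<mu> (p / 2) u)\<^sup>2 + \<sigma>\<^sup>2 * p\<^sup>2 / 4 * (lp_norm \<mu> p h)\<^sup>2"
proof -
  define q where "q = p / 2"
  have q: "q > 1" "p = 2 * q" using p by (auto simp: q_def)
  have u_cont: "continuous_on G u" by (rule slope_on_continuous[OF u(1) open_G])
  have B0: "B \<ge> 0" using u(2,3) order_trans by blast
  have int_u: "integrable \<mu> (\<lambda>x. u x powr r)" if "r > 0" for r
    using that u(2,3) B0
    by (intro integrable_bounded[of _ "B powr r"] continuous_on_powr' u_cont continuous_intros)
      (auto intro!: powr_mono2)
  have Hoelder_int: "integrable \<mu> (\<lambda>x. u x powr (p - 2) * (h x)\<^sup>2)"
    and Hoelder: "(\<integral>x. u x powr (p - 2) * (h x)\<^sup>2 \<partial>\<mu>) \<le> lp_norm \<mu> p u powr (p - 2) * (lp_norm \<mu> p h)\<^sup>2"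
  proof -
    \<comment> \<open>The Hoelder weight is \<open>1 - 2 / p\<close>, which leaves
      \<open>2 / p\<close> for the power of \<open>h\<close>.\<close>
    have exps: "p * (1 - 2 / p) = p - 2" "p * (1 - (1 - 2 / p)) = 2" "0 < 1 - 2 / p" "1 - 2 / p < 1"
      using p by (auto simp: field_simps)
    have eq: "(\<lambda>x. (u x powr p) powr (1 - 2 / p) * (h x powr p) powr (1 - (1 - 2 / p))) = (\<lambda>x. u x powr (p - 2) * (h x)\<^sup>2)"
      unfolding powr_powr exps by (simp add: powr_two[OF h(2)])
    have "(\<integral>x. u x powr p \<partial>\<mu>) powr (1 - 2 / p) = lp_norm \<mu> p u powr (p - 2)"
      using p by (simp add: lp_norm_powr diff_divide_distrib)
    moreover have "(\<integral>x. h x powr p \<partial>\<mu>) powr (1 - (1 - 2 / p)) = (lp_norm \<mu> p h)\<^sup>2"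
      using p lp_norm_powr[of p 2 \<mu> h] by (simp add: powr_two[OF lp_norm_nonneg])
    ultimately show "integrable \<mu> (\<lambda>x. u x powr (p - 2) * (h x)\<^sup>2)"
      "(\<integral>x. u x powr (p - 2) * (h x)\<^sup>2 \<partial>\<mu>) \<le> lp_norm \<mu> p u powr (p - 2) * (lp_norm \<mu> p h)\<^sup>2"
      using Hoelder_powr[OF int_u[of p] _ int _ exps(3,4)] p unfolding eq by auto
  qed
  let ?k = "\<lambda>x. q * u x powr (q - 1) * h x"
  have k2: "(?k x)\<^sup>2 = p\<^sup>2 / 4 * (u x powr (p - 2) * (h x)\<^sup>2)" for x
  proof -
    have "(u x powr (q - 1))\<^sup>2 = u x powr (p - 2)"
      using powr_power[of "u x" "q - 1" 2] q by (auto simp: power2_eq_square powr_add[symmetric])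
    then show ?thesis using q by (simp add: power_mult_distrib)
  qed
  have "(\<integral>x. (u x powr q)\<^sup>2 \<partial>\<mu>) - (\<integral>x. u x powr q \<partial>\<mu>)\<^sup>2 \<le> \<sigma>\<^sup>2 * (\<integral>x. (?k x)\<^sup>2 \<partial>\<mu>)"
  proof (rule poincare_slope)
    show "slope_on G (\<lambda>x. u x powr q) ?k"
      using u h q by (intro slope_on_powr open_G) auto
    show "\<bar>u x powr q\<bar> \<le> B powr q" for x
      using u q by (auto intro!: powr_mono2)
    show "continuous_on G ?k"
      using u q by (intro continuous_on_mult continuous_on_powr' u_cont h continuous_intros) auto
    show "integrable \<mu> (\<lambda>x. (?k x)\<^sup>2)" unfolding k2 using Hoelder_int by simp
  qed
  also have "(\<integral>x. (?k x)\<^sup>2 \<partial>\<mu>) = p\<^sup>2 / 4 * (\<integral>x. u x powr (p - 2) * (h x)\<^sup>2 \<partial>\<mu>)"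
    unfolding k2 by simp
  also have "(\<lambda>x. (u x powr q)\<^sup>2) = (\<lambda>x. u x powr p)"
    using q by (auto simp: power2_eq_square powr_add[symmetric])
  finally have "(\<integral>x. u x powr p \<partial>\<mu>) \<le> (\<integral>x. u x powr q \<partial>\<mu>)\<^sup>2
      + \<sigma>\<^sup>2 * (p\<^sup>2 / 4 * (\<integral>x. u x powr (p - 2) * (h x)\<^sup>2 \<partial>\<mu>))" by simp
  also have "\<dots> \<le> (\<integral>x. u x powr q \<partial>\<mu>)\<^sup>2
      + \<sigma>\<^sup>2 * (p\<^sup>2 / 4 * (lp_norm \<mu> p u powr (p - 2) * (lp_norm \<mu> p h)\<^sup>2))"
    using Hoelder by (intro add_left_mono mult_left_mono) auto
  also have "(\<integral>x. u x powr q \<partial>\<mu>)\<^sup>2 = (lp_norm \<mu> q u powr q)\<^sup>2"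
    using q by (simp add: lp_norm_powr_self)
  also have "\<dots> = lp_norm \<mu> q u powr (p - 2) * (lp_norm \<mu> q u)\<^sup>2"
  proof -
    have "(lp_norm \<mu> q u powr q)\<^sup>2 = lp_norm \<mu> q u powr (p - 2 + 2)"
      using q by (simp add: power2_eq_square powr_add[symmetric])
    then show ?thesis unfolding powr_add by (simp add: powr_two[OF lp_norm_nonneg])
  qed
  \<comment> \<open>Monotonicity of the norms creates the common factor
    \<open>lp_norm \<mu> p u powr (p - 2)\<close> in both terms.\<close>
  also have "\<dots> \<le> lp_norm \<mu> p u powr (p - 2) * (lp_norm \<mu> q u)\<^sup>2"
    using p q lp_norm_mono(2)[of q p u] int_u[of p]
    by (intro mult_right_mono powr_mono2) (auto simp: lp_norm_nonneg)
  finally have main: "lp_norm \<mu> p u powr p \<le> lp_norm \<mu> p u powr (p - 2) *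
      ((lp_norm \<mu> q u)\<^sup>2 + \<sigma>\<^sup>2 * p\<^sup>2 / 4 * (lp_norm \<mu> p h)\<^sup>2)"
    using p by (simp add: lp_norm_powr_self algebra_simps)
  show ?thesis
  proof (cases "lp_norm \<mu> p u = 0")
    case False
    then have pos: "lp_norm \<mu> p u > 0" using lp_norm_nonneg[of \<mu> p u] by simp
    have "lp_norm \<mu> p u powr p = lp_norm \<mu> p u powr (p - 2 + 2)" by simp
    also have "\<dots> = lp_norm \<mu> p u powr (p - 2) * (lp_norm \<mu> p u)\<^sup>2"
      unfolding powr_add by (simp add: powr_two[OF lp_norm_nonneg])
    finally show ?thesis using main pos by (simp add: q_def)
  qed simp
qed

text \<open>The constant \<open>p\<^sup>2 / 2 - 1\<close> is stable under halving: \<open>(p / 2)\<^sup>2 / 2 - 1 + p\<^sup>2 / 4 \<le> p\<^sup>2 / 2 - 1\<close>.\<close>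

lemma moment_bounded:
  assumes u: "slope_on G u h" "\<And>x. 0 \<le> u x" "\<And>x. u x \<le> B" and h: "continuous_on G h" "\<And>x. 0 \<le> h x"
    and p: "p > 2" and int: "integrable \<mu> (\<lambda>x. h x powr p)"
  shows "(lp_norm \<mu> p u)\<^sup>2 \<le> (lp_norm \<mu> 2 u)\<^sup>2 + \<sigma>\<^sup>2 * (p\<^sup>2 / 2 - 1) * (lp_norm \<mu> p h)\<^sup>2"
proof -
  \<comment> \<open>Induction on the number of halvings; for \<open>n = 0\<close> the conditions
    \<open>p \<le> 1\<close> and \<open>p > 2\<close> exclude each other.\<close>
  obtain n :: nat where "p \<le> 2 ^ n"
    using real_arch_pow[of 2 p] by (auto intro: less_imp_le)
  then show ?thesis
    using p int
  proof (induction n arbitrary: p)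
    case (Suc n)
    note step = moment_halving[OF u h Suc.prems(2,3)]
    let ?A = "\<lambda>r. lp_norm \<mu> r u" and ?H = "(lp_norm \<mu> p h)\<^sup>2"
    have "p\<^sup>2 > 2\<^sup>2" using Suc.prems by (intro power_strict_mono) auto
    then have p2: "p\<^sup>2 > 4" by simp
    have B0: "B \<ge> 0" using u(2,3) order_trans by blast
    have "integrable \<mu> (\<lambda>x. u x powr 2)"
      using u(2,3) B0 slope_on_continuous[OF u(1) open_G]
      by (intro integrable_bounded[of _ "B powr 2"] continuous_on_powr' continuous_intros)
        (auto intro!: powr_mono2)
    show ?case
    proof (cases "p / 2 \<le> 2")
      \<comment> \<open>The last halving: now \<open>p / 2\<close> is at most 2, so its norm is
        below the 2-norm, and \<open>p\<^sup>2 / 4 \<le> p\<^sup>2 / 2 - 1\<close> because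
        \<open>p\<^sup>2 > 4\<close>.\<close>
      case True
      have "?A (p / 2) \<le> ?A 2"
        using True Suc.prems \<open>integrable \<mu> (\<lambda>x. u x powr 2)\<close> by (intro lp_norm_mono(2)) auto
      then have "(?A (p / 2))\<^sup>2 \<le> (?A 2)\<^sup>2" by (intro power_mono lp_norm_nonneg)
      moreover have "\<sigma>\<^sup>2 * p\<^sup>2 / 4 * ?H \<le> \<sigma>\<^sup>2 * (p\<^sup>2 / 2 - 1) * ?H"
      proof (rule mult_right_mono)
        have "\<sigma>\<^sup>2 * (p\<^sup>2 / 4) \<le> \<sigma>\<^sup>2 * (p\<^sup>2 / 2 - 1)"
          using p2 by (intro mult_left_mono) auto
        then show "\<sigma>\<^sup>2 * p\<^sup>2 / 4 \<le> \<sigma>\<^sup>2 * (p\<^sup>2 / 2 - 1)" by simp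
      qed simp
      ultimately show ?thesis using step by linarith
    next
      case False
      then have "(?A (p / 2))\<^sup>2 \<le> (?A 2)\<^sup>2 + \<sigma>\<^sup>2 * ((p / 2)\<^sup>2 / 2 - 1) * (lp_norm \<mu> (p / 2) h)\<^sup>2"
        using Suc.prems lp_norm_mono(1)[of "p / 2" p h] by (intro Suc.IH) auto
      also have "\<dots> \<le> (?A 2)\<^sup>2 + \<sigma>\<^sup>2 * ((p / 2)\<^sup>2 / 2 - 1) * ?H"
      proof (intro add_left_mono mult_left_mono power_mono lp_norm_nonneg)
        show "lp_norm \<mu> (p / 2) h \<le> lp_norm \<mu> p h"
          using Suc.prems by (intro lp_norm_mono(2)) auto
        have "(p / 2)\<^sup>2 > 2\<^sup>2" using False by (intro power_strict_mono) auto
        then show "0 \<le> \<sigma>\<^sup>2 * ((p / 2)\<^sup>2 / 2 - 1)" by simp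
      qed
      finally have "(?A p)\<^sup>2 \<le> (?A 2)\<^sup>2 + (\<sigma>\<^sup>2 * ((p / 2)\<^sup>2 / 2 - 1) * ?H + \<sigma>\<^sup>2 * p\<^sup>2 / 4 * ?H)"
        using step by simp
      also have "\<sigma>\<^sup>2 * ((p / 2)\<^sup>2 / 2 - 1) * ?H + \<sigma>\<^sup>2 * p\<^sup>2 / 4 * ?H
          = \<sigma>\<^sup>2 * (p\<^sup>2 * 3 / 8 - 1) * ?H"
        by (simp add: power_divide algebra_simps)
      also have "(?A 2)\<^sup>2 + \<dots> \<le> (?A 2)\<^sup>2 + \<sigma>\<^sup>2 * (p\<^sup>2 / 2 - 1) * ?H"
        by (intro add_left_mono mult_right_mono mult_left_mono) auto
      finally show ?thesis .
    qed
  qed simp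
qed

text \<open>The truncations \<open>min (u x) N\<close> keep the slope bound \<open>h\<close> and
  have 2-norm at most that of \<open>u\<close>, so the estimate for bounded functions is uniform in
  \<open>N\<close>.\<close>

lemma moment:
  assumes u: "slope_on G u h" "\<And>x. 0 \<le> u x" "integrable \<mu> (\<lambda>x. u x powr 2)"
    and h: "continuous_on G h" "\<And>x. 0 \<le> h x" "integrable \<mu> (\<lambda>x. h x powr p)" and p: "p > 2"
  shows "integrable \<mu> (\<lambda>x. u x powr p)"
    and "(lp_norm \<mu> p u)\<^sup>2 \<le> (lp_norm \<mu> 2 u)\<^sup>2 + \<sigma>\<^sup>2 * (p\<^sup>2 / 2 - 1) * (lp_norm \<mu> p h)\<^sup>2"
proof -
  let ?C = "(lp_norm \<mu> 2 u)\<^sup>2 + \<sigma>\<^sup>2 * (p\<^sup>2 / 2 - 1) * (lp_norm \<mu> p h)\<^sup>2"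
  have u_cont: "continuous_on G u" by (rule slope_on_continuous[OF u(1) open_G])
  have "p\<^sup>2 > 2\<^sup>2" using p by (intro power_strict_mono) auto
  then have C0: "?C \<ge> 0" by simp
  have fin: "integrable \<mu> (\<lambda>x. min (u x) (real N) powr r)" if "r > 0" for r N
    using that u(2) by (intro integrable_bounded[of _ "real N powr r"] continuous_on_powr' continuous_intros u_cont)
      (auto intro!: powr_mono2)
  have "(\<integral>x. min (u x) (real N) powr p \<partial>\<mu>) \<le> ?C powr (p / 2)" for N
  proof -
    let ?v = "\<lambda>x. min (u x) (real N)"
    have "slope_on G ?v h"
      by (rule slope_on_compose_lipschitz[OF u(1)]) (auto simp: min_def)
    then have "(lp_norm \<mu> p ?v)\<^sup>2 \<le> (lp_norm \<mu> 2 ?v)\<^sup>2 + \<sigma>\<^sup>2 * (p\<^sup>2 / 2 - 1) * (lp_norm \<mu> p h)\<^sup>2"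
      using u h p by (intro moment_bounded[where B = "real N"]) auto
    moreover have "lp_norm \<mu> 2 ?v \<le> lp_norm \<mu> 2 u"
      unfolding lp_norm_def using fin[of 2 N] u
      by (intro powr_mono2 integral_mono integral_nonneg) auto
    then have "(lp_norm \<mu> 2 ?v)\<^sup>2 \<le> (lp_norm \<mu> 2 u)\<^sup>2" by (intro power_mono lp_norm_nonneg)
    ultimately have "(lp_norm \<mu> p ?v)\<^sup>2 \<le> ?C" by linarith
    then have "((lp_norm \<mu> p ?v)\<^sup>2) powr (p / 2) \<le> ?C powr (p / 2)"
      using p by (intro powr_mono2) auto
    also have "((lp_norm \<mu> p ?v)\<^sup>2) powr (p / 2) = lp_norm \<mu> p ?v powr p"
      unfolding powr_two[OF lp_norm_nonneg, symmetric] powr_powr by simp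
    finally show ?thesis using p by (simp add: lp_norm_powr_self)
  qed
  then have *: "integrable \<mu> (\<lambda>x. u x powr p) \<and> (\<integral>x. u x powr p \<partial>\<mu>) \<le> ?C powr (p / 2)"
    using p u(2) fin[of p] measurable_continuous[OF u_cont] by (intro integrable_of_truncations) auto
  then show "integrable \<mu> (\<lambda>x. u x powr p)" by simp
  have "(lp_norm \<mu> p u)\<^sup>2 = (\<integral>x. u x powr p \<partial>\<mu>) powr (2 / p)"
    using p lp_norm_powr[of p 2 \<mu> u] by (simp add: powr_two[OF lp_norm_nonneg])
  also have "\<dots> \<le> (?C powr (p / 2)) powr (2 / p)"
    using * p by (intro powr_mono2 Bochner_Integration.integral_nonneg) auto
  also have "\<dots> = ?C" using p C0 by (simp add: powr_powr)
  finally show "(lp_norm \<mu> p u)\<^sup>2 \<le> ?C" .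
qed

text \<open>Weaker than \<open>moment\<close> but linear in the norms, so that it can be iterated
  over the orders of derivatives. A sum of squares of nonnegative numbers is at most the square of
  their sum.\<close>

lemma moment_step:
  assumes u: "slope_on G u h" "\<And>x. 0 \<le> u x" "integrable \<mu> (\<lambda>x. u x powr 2)"
    and h: "continuous_on G h" "\<And>x. 0 \<le> h x" "integrable \<mu> (\<lambda>x. h x powr p)" and p: "p > 2"
  shows "lp_norm \<mu> p u \<le> lp_norm \<mu> 2 u + \<sigma> * p / sqrt 2 * lp_norm \<mu> p h"
proof (rule power2_le_imp_le)
  have "(lp_norm \<mu> p u)\<^sup>2 \<le> (lp_norm \<mu> 2 u)\<^sup>2 + \<sigma>\<^sup>2 * (p\<^sup>2 / 2 - 1) * (lp_norm \<mu> p h)\<^sup>2"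
    by (rule moment(2)[OF assms])
  also have "\<dots> \<le> (lp_norm \<mu> 2 u)\<^sup>2 + \<sigma>\<^sup>2 * (p\<^sup>2 / 2) * (lp_norm \<mu> p h)\<^sup>2"
    by (intro add_left_mono mult_right_mono mult_left_mono) auto
  also have "\<sigma>\<^sup>2 * (p\<^sup>2 / 2) * (lp_norm \<mu> p h)\<^sup>2 = (\<sigma> * p / sqrt 2 * lp_norm \<mu> p h)\<^sup>2"
    by (simp add: power_mult_distrib power_divide)
  also have "(lp_norm \<mu> 2 u)\<^sup>2 + \<dots> \<le> (lp_norm \<mu> 2 u + \<sigma> * p / sqrt 2 * lp_norm \<mu> p h)\<^sup>2"
    using p \<sigma>_pos lp_norm_nonneg[of \<mu> 2 u] lp_norm_nonneg[of \<mu> p h] by (simp add: power2_sum)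
  finally show "(lp_norm \<mu> p u)\<^sup>2 \<le> (lp_norm \<mu> 2 u + \<sigma> * p / sqrt 2 * lp_norm \<mu> p h)\<^sup>2" .
qed (use p \<sigma>_pos lp_norm_nonneg[of \<mu>] in \<open>simp add: add_nonneg_nonneg\<close>)

text \<open>Truncation between -N and N destroys the zero mean, so the squared mean stays on the
  right. Bounded by the squared L^1 norm of \<open>f\<close>, it first yields square integrability;
  afterwards it tends to 0 and disappears.\<close>

lemma poincare_centered:
  assumes f: "slope_on G f h" "integrable \<mu> f" "(\<integral>x. f x \<partial>\<mu>) = 0"
    and h: "continuous_on G h" "integrable \<mu> (\<lambda>x. (h x)\<^sup>2)"
  shows "integrable \<mu> (\<lambda>x. (f x)\<^sup>2)" and "(\<integral>x. (f x)\<^sup>2 \<partial>\<mu>) \<le> \<sigma>\<^sup>2 * (\<integral>x. (h x)\<^sup>2 \<partial>\<mu>)"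
proof -
  have f_cont: "continuous_on G f" by (rule slope_on_continuous[OF f(1) open_G])
  have [measurable]: "f \<in> borel_measurable \<mu>" using f by simp
  define c where "c N x = max (- real N) (min (f x) (real N))" for N x
  have c_abs: "\<bar>c N x\<bar> = min \<bar>f x\<bar> (real N)" for N x by (auto simp: c_def)
  then have c_le: "\<bar>c N x\<bar> \<le> \<bar>f x\<bar>" for N x by simp
  have [measurable]: "c N \<in> borel_measurable \<mu>" for N unfolding c_def by measurable
  have c_int: "integrable \<mu> (c N)" for N
    by (rule Bochner_Integration.integrable_bound[OF f(2)]) (auto simp: c_le)
  have c_lim: "(\<lambda>N. c N x) \<longlonglongrightarrow> f x" for x
  proof (rule tendsto_eventually)
    have "\<forall>\<^sub>F N in sequentially. nat \<lceil>\<bar>f x\<bar>\<rceil> \<le> N" by (rule eventually_ge_at_top)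
    then show "\<forall>\<^sub>F N in sequentially. c N x = f x"
      by eventually_elim (auto simp: c_def nat_le_iff ceiling_le_iff)
  qed
  have var: "(\<integral>x. (c N x)\<^sup>2 \<partial>\<mu>) \<le> \<sigma>\<^sup>2 * (\<integral>x. (h x)\<^sup>2 \<partial>\<mu>) + (\<integral>x. c N x \<partial>\<mu>)\<^sup>2" for N
  proof -
    have "slope_on G (c N) h"
      unfolding c_def[abs_def] by (rule slope_on_compose_lipschitz[OF f(1)]) (auto simp: min_def max_def)
    from poincare_slope[OF this _ h, of "real N"] show ?thesis by (simp add: c_abs)
  qed
  have "\<bar>\<integral>x. c N x \<partial>\<mu>\<bar> \<le> (\<integral>x. \<bar>f x\<bar> \<partial>\<mu>)" for N
  proof -
    have "\<bar>\<integral>x. c N x \<partial>\<mu>\<bar> \<le> (\<integral>x. \<bar>c N x\<bar> \<partial>\<mu>)"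
      using Bochner_Integration.integral_norm_bound[of \<mu> "c N"] by simp
    also have "\<dots> \<le> (\<integral>x. \<bar>f x\<bar> \<partial>\<mu>)"
      using c_int f(2) c_le by (intro integral_mono) auto
    finally show ?thesis .
  qed
  then have "(\<integral>x. c N x \<partial>\<mu>)\<^sup>2 \<le> (\<integral>x. \<bar>f x\<bar> \<partial>\<mu>)\<^sup>2" for N
    by (simp add: abs_le_square_iff[symmetric] order_trans[OF _ abs_ge_self])
  then have "(\<integral>x. min \<bar>f x\<bar> (real N) powr 2 \<partial>\<mu>) \<le> \<sigma>\<^sup>2 * (\<integral>x. (h x)\<^sup>2 \<partial>\<mu>) + (\<integral>x. \<bar>f x\<bar> \<partial>\<mu>)\<^sup>2" for N
    using var[of N] by (simp add: c_abs[symmetric] add_mono order_trans[OF _ add_left_mono])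
  moreover have "integrable \<mu> (\<lambda>x. min \<bar>f x\<bar> (real N) powr 2)" for N
    by (rule integrable_const_bound[of _ "real N powr 2"]) (auto intro!: AE_I2 power_mono)
  ultimately have "integrable \<mu> (\<lambda>x. \<bar>f x\<bar> powr 2)"
    using integrable_of_truncations[of "\<lambda>x. \<bar>f x\<bar>" \<mu> 2
        "\<sigma>\<^sup>2 * (\<integral>x. (h x)\<^sup>2 \<partial>\<mu>) + (\<integral>x. \<bar>f x\<bar> \<partial>\<mu>)\<^sup>2"] by simp
  then show int: "integrable \<mu> (\<lambda>x. (f x)\<^sup>2)" by simp
  have "(\<lambda>N. \<integral>x. (c N x)\<^sup>2 \<partial>\<mu>) \<longlonglongrightarrow> (\<integral>x. (f x)\<^sup>2 \<partial>\<mu>)"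
  proof (rule integral_dominated_convergence[OF _ _ int])
    show "AE x in \<mu>. norm ((c N x)\<^sup>2) \<le> (f x)\<^sup>2" for N
      using c_le by (auto simp: abs_le_square_iff[symmetric])
    show "AE x in \<mu>. (\<lambda>N. (c N x)\<^sup>2) \<longlonglongrightarrow> (f x)\<^sup>2"
      by (intro AE_I2 tendsto_power c_lim)
  qed measurable
  moreover have "(\<lambda>N. \<sigma>\<^sup>2 * (\<integral>x. (h x)\<^sup>2 \<partial>\<mu>) + (\<integral>x. c N x \<partial>\<mu>)\<^sup>2)
      \<longlonglongrightarrow> \<sigma>\<^sup>2 * (\<integral>x. (h x)\<^sup>2 \<partial>\<mu>) + (\<integral>x. f x \<partial>\<mu>)\<^sup>2"
  proof (intro tendsto_intros)
    show "(\<lambda>N. \<integral>x. c N x \<partial>\<mu>) \<longlonglongrightarrow> (\<integral>x. f x \<partial>\<mu>)"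
      by (rule integral_dominated_convergence[where w = "\<lambda>x. \<bar>f x\<bar>"])
        (use f(2) c_le c_lim in auto)
  qed
  ultimately have "(\<integral>x. (f x)\<^sup>2 \<partial>\<mu>) \<le> \<sigma>\<^sup>2 * (\<integral>x. (h x)\<^sup>2 \<partial>\<mu>) + (\<integral>x. f x \<partial>\<mu>)\<^sup>2"
    using var by (intro LIMSEQ_le[where X = "\<lambda>N. \<integral>x. (c N x)\<^sup>2 \<partial>\<mu>"]) auto
  then show "(\<integral>x. (f x)\<^sup>2 \<partial>\<mu>) \<le> \<sigma>\<^sup>2 * (\<integral>x. (h x)\<^sup>2 \<partial>\<mu>)" using f(3) by simp
qed

text \<open>For centred \<open>f\<close> the squared 2-norm is at most
  \<open>\<sigma>\<^sup>2\<close> times that of \<open>h\<close>. This exactly fills the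
  \<open>- 1\<close> kept in \<open>moment\<close>: the two terms add up to
  \<open>\<sigma>\<^sup>2 * p\<^sup>2 / 2\<close> and no 2-norm remains.\<close>

lemma moment_step_centered:
  assumes f: "slope_on G f h" "integrable \<mu> f" "(\<integral>x. f x \<partial>\<mu>) = 0"
    and h: "continuous_on G h" "\<And>x. 0 \<le> h x" "integrable \<mu> (\<lambda>x. h x powr p)" and p: "p > 2"
  shows "integrable \<mu> (\<lambda>x. \<bar>f x\<bar> powr p)"
    and "lp_norm \<mu> p (\<lambda>x. \<bar>f x\<bar>) \<le> \<sigma> * p / sqrt 2 * lp_norm \<mu> p h"
proof -
  have p2: "integrable \<mu> (\<lambda>x. h x powr 2)" "lp_norm \<mu> 2 h \<le> lp_norm \<mu> p h"
    using p h(3) lp_norm_mono[of 2 p h] by auto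
  then have "integrable \<mu> (\<lambda>x. (h x)\<^sup>2)" by (simp add: powr_two[OF h(2)])
  note f2 = poincare_centered[OF f h(1) this]
  have slope: "slope_on G (\<lambda>x. \<bar>f x\<bar>) h"
    by (rule slope_on_compose_lipschitz[OF f(1)]) auto
  have int2: "integrable \<mu> (\<lambda>x. \<bar>f x\<bar> powr 2)" using f2(1) by simp
  note m = moment[OF slope _ int2 h p]
  show "integrable \<mu> (\<lambda>x. \<bar>f x\<bar> powr p)" using m(1) by simp
  have sq: "(lp_norm \<mu> 2 v)\<^sup>2 = (\<integral>x. v x powr 2 \<partial>\<mu>)" for v
    using lp_norm_powr_self[of 2 \<mu> v] by (simp add: powr_two[OF lp_norm_nonneg])
  have "(lp_norm \<mu> 2 (\<lambda>x. \<bar>f x\<bar>))\<^sup>2 \<le> \<sigma>\<^sup>2 * (lp_norm \<mu> 2 h)\<^sup>2"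
    using f2(2) unfolding sq by (simp add: powr_two[OF h(2)])
  also have "\<dots> \<le> \<sigma>\<^sup>2 * (lp_norm \<mu> p h)\<^sup>2"
    using p2(2) by (intro mult_left_mono power_mono lp_norm_nonneg) auto
  finally have "(lp_norm \<mu> p (\<lambda>x. \<bar>f x\<bar>))\<^sup>2 \<le> \<sigma>\<^sup>2 * (lp_norm \<mu> p h)\<^sup>2 + \<sigma>\<^sup>2 * (p\<^sup>2 / 2 - 1) * (lp_norm \<mu> p h)\<^sup>2"
    using m(2) by simp
  also have "\<dots> = (\<sigma> * p / sqrt 2 * lp_norm \<mu> p h)\<^sup>2"
    by (simp add: power_mult_distrib power_divide algebra_simps)
  finally show "lp_norm \<mu> p (\<lambda>x. \<bar>f x\<bar>) \<le> \<sigma> * p / sqrt 2 * lp_norm \<mu> p h"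
    by (rule power2_le_imp_le) (use p \<sigma>_pos lp_norm_nonneg[of \<mu>] in simp)
qed

end

section \<open>Operator norms of derivatives\<close>

lemma Ck_on_iter_pderiv: "Ck_on (k + length is) G f \<Longrightarrow> Ck_on k G (iter_pderiv is f)"
proof (induction "is" arbitrary: k)
  case (Cons i "is")
  then have "Ck_on (Suc k) G (iter_pderiv is f)" using Cons.IH[of "Suc k"] by simp
  then show ?case by simp
qed simp

text \<open>\<open>deriv_form\<close> with arbitrary coefficients in place of the partial
  derivatives, so that differences and Taylor remainders are forms as well.\<close>

definition multiform :: "nat \<Rightarrow> ('n list \<Rightarrow> real) \<Rightarrow> (nat \<Rightarrow> real ^ 'n::finite) \<Rightarrow> real" where
  "multiform k T v = (\<Sum>is\<in>{is. length is = k}. T is * (\<Prod>j<k. v j $ (is ! j)))"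

lemma deriv_form_multiform: "deriv_form k f x = multiform k (\<lambda>is. iter_pderiv is f x)"
  by (simp add: deriv_form_def multiform_def fun_eq_iff)

lemma multiform_diff: "multiform k (\<lambda>is. S is - T is) v = multiform k S v - multiform k T v"
  by (simp add: multiform_def left_diff_distrib sum_subtractf)

lemma multiform_add: "multiform k (\<lambda>is. S is + T is) v = multiform k S v + multiform k T v"
  by (simp add: multiform_def distrib_right sum.distrib)

text \<open>Components of unit vectors are at most 1 in absolute value. This crude bound makes the
  supremum in \<open>op_norm\<close> finite and controls error terms with small
  coefficients.\<close>

lemma multiform_le:
  assumes "\<forall>j<k. norm (v j) = 1"
  shows "\<bar>multiform k T v\<bar> \<le> (\<Sum>is\<in>{is. length is = k}. \<bar>T is\<bar>)"
proof -
  have "\<bar>T is * (\<Prod>j<k. v j $ (is ! j))\<bar> \<le> \<bar>T is\<bar>" for "is"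
  proof -
    have "\<bar>\<Prod>j<k. v j $ (is ! j)\<bar> \<le> 1"
      unfolding abs_prod using assms component_le_norm_cart[of "v _"] by (intro prod_le_1) (metis abs_ge_zero lessThan_iff)
    then show ?thesis by (simp add: abs_mult mult_left_le)
  qed
  then show ?thesis unfolding multiform_def by (intro order_trans[OF sum_abs] sum_mono)
qed

lemma finite_lists_length: "finite {is :: 'n::finite list. length is = k}"
  using finite_lists_length_eq[of "UNIV :: 'n set" k] by simp

lemma sum_lists_Suc:
  fixes F :: "'n::finite list \<Rightarrow> real"
  shows "(\<Sum>is\<in>{is. length is = Suc k}. F is) = (\<Sum>is\<in>{is. length is = k}. \<Sum>i\<in>UNIV. F (i # is))"
  unfolding sum.cartesian_product
  by (rule sum.reindex_bij_witness[of _ "\<lambda>(is, i). i # is" "\<lambda>is. (tl is, hd is)"])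
    (auto simp: length_Suc_conv)

text \<open>Contracting the first index with \<open>w\<close> amounts to a new first argument;
  \<open>case_nat w v\<close> is \<open>v\<close> with \<open>w\<close> prepended.\<close>

lemma multiform_Suc:
  fixes T :: "'n::finite list \<Rightarrow> real"
  shows "multiform k (\<lambda>is. \<Sum>i\<in>UNIV. T (i # is) * w $ i) v = multiform (Suc k) T (case_nat w v)"
proof -
  have "multiform (Suc k) T (case_nat w v) =
      (\<Sum>is\<in>{is. length is = k}. \<Sum>i\<in>UNIV. T (i # is) * (w $ i * (\<Prod>j<k. v j $ (is ! j))))"
    by (simp add: multiform_def sum_lists_Suc prod.lessThan_Suc_shift del: prod.lessThan_Suc)
  then show ?thesis by (simp add: multiform_def sum_distrib_right mult.assoc)
qed

lemma multiform_scale_head: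
  "multiform (Suc k) T (case_nat (c *\<^sub>R w) v) = c * multiform (Suc k) T (case_nat w v)"
  by (simp add: multiform_def prod.lessThan_Suc_shift sum_distrib_left mult_ac del: prod.lessThan_Suc)

section \<open>The operator norm as a supremum over unit vectors\<close>

lemma unit_vectors_exist: "{v :: nat \<Rightarrow> real ^ 'n::finite. \<forall>j<k. norm (v j) = 1} \<noteq> {}"
proof -
  have "(\<lambda>_. axis undefined 1) \<in> {v :: nat \<Rightarrow> real ^ 'n. \<forall>j<k. norm (v j) = 1}"
    by (simp add: norm_axis_1)
  then show ?thesis by (metis empty_iff)
qed

lemma deriv_form_le_op_norm:
  fixes v :: "nat \<Rightarrow> real ^ 'n::finite"
  assumes "\<forall>j<k. norm (v j) = 1"
  shows "deriv_form k f x v \<le> op_norm k f x"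
  unfolding op_norm_def
proof (rule cSUP_upper)
  show "bdd_above (deriv_form k f x ` {v. \<forall>j<k. norm (v j) = 1})"
    using multiform_le[where k = k and T = "\<lambda>is. iter_pderiv is f x"]
    unfolding deriv_form_multiform by (intro bdd_aboveI2) (auto simp: abs_le_iff)
qed (use assms in simp)

lemma op_norm_least:
  assumes "\<And>v. \<forall>j<k. norm (v j) = 1 \<Longrightarrow> deriv_form k f x v \<le> c"
  shows "op_norm k f x \<le> c"
  unfolding op_norm_def using assms by (intro cSUP_least unit_vectors_exist) auto

text \<open>Order 0 gives \<open>f\<close> and not its absolute value. The slope of \<open>f\<close>
  itself is therefore the case \<open>k = 0\<close> of \<open>op_norm_slope\<close>, and
  nonnegativity is claimed from order 1 on.\<close>

lemma op_norm_0: "op_norm 0 f x = f x"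
proof -
  have "{is :: 'n list. length is = 0} = {[]}" by auto
  then have "deriv_form 0 f x v = f x" for v by (simp add: deriv_form_def)
  then show ?thesis by (simp add: op_norm_def)
qed

text \<open>Negating the first argument flips the sign of the form, so the supremum dominates some
  number and its negative.\<close>

lemma op_norm_nonneg:
  fixes x :: "real ^ 'n::finite"
  shows "op_norm (Suc k) f x \<ge> 0"
proof -
  define e :: "real ^ 'n" where "e = axis undefined 1"
  have e: "norm e = 1" by (simp add: e_def norm_axis_1)
  have "deriv_form (Suc k) f x (case_nat e (\<lambda>_. e)) \<le> op_norm (Suc k) f x"
    "deriv_form (Suc k) f x (case_nat ((- 1) *\<^sub>R e) (\<lambda>_. e)) \<le> op_norm (Suc k) f x"
    by (intro deriv_form_le_op_norm; simp add: e split: nat.split)+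
  then show ?thesis unfolding deriv_form_multiform multiform_scale_head by linarith
qed

lemma multiform_head_le_op_norm:
  fixes w :: "real ^ 'n::finite"
  assumes "\<forall>j<k. norm (v j) = 1"
  shows "deriv_form (Suc k) f x (case_nat w v) \<le> norm w * op_norm (Suc k) f x"
proof (cases "w = 0")
  case True
  then show ?thesis
    using multiform_scale_head[of k _ 0 w v] by (simp add: deriv_form_multiform)
next
  case False
  have "deriv_form (Suc k) f x (case_nat w v)
      = norm w * deriv_form (Suc k) f x (case_nat ((1 / norm w) *\<^sub>R w) v)"
    unfolding deriv_form_multiform multiform_scale_head using False by simp
  also have "\<dots> \<le> norm w * op_norm (Suc k) f x"
    using False assms by (intro mult_left_mono deriv_form_le_op_norm) (auto split: nat.split)
  finally show ?thesis .
qed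

lemma op_norm_diff_le:
  fixes x y :: "real ^ 'n::finite"
  shows "op_norm k f x - op_norm k f y \<le> (\<Sum>is\<in>{is. length is = k}. \<bar>iter_pderiv is f x - iter_pderiv is f y\<bar>)"
proof -
  have "op_norm k f x \<le> op_norm k f y + (\<Sum>is\<in>{is. length is = k}. \<bar>iter_pderiv is f x - iter_pderiv is f y\<bar>)"
  proof (rule op_norm_least)
    fix v :: "nat \<Rightarrow> real ^ 'n" assume v: "\<forall>j<k. norm (v j) = 1"
    show "deriv_form k f x v \<le> op_norm k f y + (\<Sum>is\<in>{is. length is = k}. \<bar>iter_pderiv is f x - iter_pderiv is f y\<bar>)"
      using deriv_form_le_op_norm[where f = f and x = y, OF v]
        multiform_le[where T = "\<lambda>is. iter_pderiv is f x - iter_pderiv is f y", OF v]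
      unfolding multiform_diff deriv_form_multiform by linarith
  qed
  then show ?thesis by simp
qed

lemma op_norm_continuous:
  assumes "Ck_on k G f"
  shows "continuous_on G (op_norm k f)"
  unfolding continuous_on_def
proof
  fix x assume x: "x \<in> G"
  let ?S = "\<lambda>y. \<Sum>is\<in>{is. length is = k}. \<bar>iter_pderiv is f y - iter_pderiv is f x\<bar>"
  have "continuous_on G (iter_pderiv is f)" if "length is = k" for "is"
    using Ck_on_iter_pderiv[of 0 "is" G f] assms that by simp
  then have "(?S \<longlongrightarrow> (\<Sum>is\<in>{is :: 'a list. length is = k}. \<bar>iter_pderiv is f x - iter_pderiv is f x\<bar>)) (at x within G)"
    using x by (intro tendsto_sum tendsto_rabs tendsto_diff tendsto_const) (auto simp: continuous_on_def)
  then have "(?S \<longlongrightarrow> 0) (at x within G)" by simp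
  then have "((\<lambda>y. op_norm k f y - op_norm k f x) \<longlongrightarrow> 0) (at x within G)"
  proof (rule Lim_null_comparison[rotated], intro always_eventually allI)
    show "norm (op_norm k f y - op_norm k f x) \<le> ?S y" for y
      using op_norm_diff_le[of k f x y] op_norm_diff_le[of k f y x]
      by (simp add: abs_le_iff abs_minus_commute)
  qed
  then show "(op_norm k f \<longlongrightarrow> op_norm k f x) (at x within G)" by (simp add: LIM_zero_iff)
qed

text \<open>For fixed unit vectors the increment of the form of order k is the form of order k+1
  with \<open>y - x\<close> in first place, plus a remainder form. Its coefficients are finitely
  many first-order Taylor remainders, so the estimate is uniform in the vectors and survives the
  suprema.\<close>

lemma op_norm_slope:
  fixes f :: "real ^ 'n::finite \<Rightarrow> real"
  assumes G: "open G" and f: "Ck_on (Suc k) G f"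
  shows "slope_on G (op_norm k f) (op_norm (Suc k) f)"
  unfolding slope_on_def
proof (intro ballI allI impI)
  fix x and \<epsilon> :: real assume x: "x \<in> G" and \<epsilon>: "\<epsilon> > 0"
  let ?L = "{is :: 'n list. length is = k}"
  let ?R = "\<lambda>y is. iter_pderiv is f y - iter_pderiv is f x - (\<Sum>i\<in>UNIV. iter_pderiv (i # is) f x * (y - x) $ i)"
  \<comment> \<open>Distributes \<open>\<epsilon>\<close> over the finitely many
    coefficients.\<close>
  define c where "c = \<epsilon> / (card ?L + 1)"
  have c: "c > 0" "card ?L * c \<le> \<epsilon>" using \<epsilon> by (auto simp: c_def field_simps)
  have "\<forall>\<^sub>F y in nhds x. \<bar>?R y is\<bar> \<le> c * dist y x" if "is \<in> ?L" for "is"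
  proof -
    have "Ck_on 1 G (iter_pderiv is f)"
      using Ck_on_iter_pderiv[of 1 "is" G f] f that by simp
    then have "iter_pderiv is f differentiable at x"
      using G x by (auto simp: differentiable_on_eq_differentiable_at)
    from has_derivative_gradient[OF this]
    have "\<forall>\<^sub>F y in nhds x. norm (iter_pderiv is f y - iter_pderiv is f x - gradient (iter_pderiv is f) x \<bullet> (y - x))
        \<le> c * norm (y - x)"
      using c(1) by (auto simp: has_derivative_within_alt eventually_nhds_metric dist_norm)
    then show ?thesis by (simp add: gradient_def inner_vec_def dist_norm)
  qed
  then have "\<forall>\<^sub>F y in nhds x. \<forall>is\<in>?L. \<bar>?R y is\<bar> \<le> c * dist y x"
    by (intro eventually_ball_finite finite_lists_length) auto
  then show "\<forall>\<^sub>F y in nhds x. \<bar>op_norm k f y - op_norm k f x\<bar> \<le> (op_norm (Suc k) f x + \<epsilon>) * dist y x"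
  proof eventually_elim
    case (elim y)
    have "(\<Sum>is\<in>?L. \<bar>?R y is\<bar>) \<le> card ?L * (c * dist y x)"
      using elim by (intro sum_bounded_above) auto
    also have "\<dots> \<le> \<epsilon> * dist y x"
      using c(2) mult_right_mono[of "card ?L * c" \<epsilon> "dist y x"] by (simp add: mult.assoc)
    finally have R: "(\<Sum>is\<in>?L. \<bar>?R y is\<bar>) \<le> \<epsilon> * dist y x" .
    have form: "deriv_form k f y v - deriv_form k f x v = deriv_form (Suc k) f x (case_nat (y - x) v) + multiform k (?R y) v" for v
      unfolding deriv_form_multiform multiform_Suc[symmetric] multiform_diff[symmetric] multiform_add[symmetric]
      by simp
    \<comment> \<open>The reversed direction supplies the lower bound needed for the absolute
      value.\<close>
    have neg: "deriv_form (Suc k) f x (case_nat (x - y) v) = - deriv_form (Suc k) f x (case_nat (y - x) v)" for v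
      using multiform_scale_head[of k _ "- 1" "y - x" v] by (simp add: deriv_form_multiform)
    have main: "\<bar>deriv_form k f y v - deriv_form k f x v\<bar> \<le> (op_norm (Suc k) f x + \<epsilon>) * dist y x"
      if v: "\<forall>j<k. norm (v j) = 1" for v
    proof -
      have "deriv_form (Suc k) f x (case_nat (y - x) v) \<le> dist y x * op_norm (Suc k) f x"
        "deriv_form (Suc k) f x (case_nat (x - y) v) \<le> dist y x * op_norm (Suc k) f x"
        using multiform_head_le_op_norm[where f = f and x = x, OF v] by (metis dist_norm dist_commute)+
      moreover have "\<bar>multiform k (?R y) v\<bar> \<le> \<epsilon> * dist y x"
        using multiform_le[OF v] R by (rule order_trans)
      moreover have "(op_norm (Suc k) f x + \<epsilon>) * dist y x = dist y x * op_norm (Suc k) f x + \<epsilon> * dist y x"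
        by (simp add: algebra_simps)
      ultimately show ?thesis unfolding form neg abs_le_iff by linarith
    qed
    have "op_norm k f y \<le> op_norm k f x + (op_norm (Suc k) f x + \<epsilon>) * dist y x"
    proof (rule op_norm_least)
      fix v :: "nat \<Rightarrow> real ^ 'n" assume v: "\<forall>j<k. norm (v j) = 1"
      show "deriv_form k f y v \<le> op_norm k f x + (op_norm (Suc k) f x + \<epsilon>) * dist y x"
        using main[OF v] deriv_form_le_op_norm[where f = f and x = x, OF v] unfolding abs_le_iff by linarith
    qed
    moreover have "op_norm k f x \<le> op_norm k f y + (op_norm (Suc k) f x + \<epsilon>) * dist y x"
    proof (rule op_norm_least)
      fix v :: "nat \<Rightarrow> real ^ 'n" assume v: "\<forall>j<k. norm (v j) = 1"
      show "deriv_form k f x v \<le> op_norm k f y + (op_norm (Suc k) f x + \<epsilon>) * dist y x"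
        using main[OF v] deriv_form_le_op_norm[where f = f and x = y, OF v] unfolding abs_le_iff by linarith
    qed
    ultimately show ?case unfolding abs_le_iff by linarith
  qed
qed

section \<open>The tail bound\<close>

text \<open>A positive lower bound excludes \<open>X = \<infinity>\<close>, for which the quotient
  is 0; if the denominator vanishes, the inequality between reals is trivial.\<close>

lemma ennreal_quotient_bound:
  assumes "ennreal c \<le> ennreal a / (ennreal \<sigma> * ennreal_powr X (1 / real k))" "c > 0" "a \<ge> 0" "\<sigma> > 0"
  obtains x where "x \<ge> 0" "X = ennreal x" "c * (\<sigma> * x powr (1 / real k)) \<le> a"
proof (cases X)
  case top
  then have "ennreal c \<le> 0"
    using assms by (simp add: ennreal_powr_def ennreal_mult_top)
  then show ?thesis using assms(2) by simp
next
  case (real x)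
  show ?thesis
  proof (rule that[OF real])
    let ?D = "\<sigma> * x powr (1 / real k)"
    show "c * ?D \<le> a"
    proof (cases "?D = 0")
      case False
      then have D: "?D > 0" using assms(4) by (simp add: less_le)
      have "ennreal c \<le> ennreal a / ennreal ?D"
        using assms real by (simp add: ennreal_powr_def ennreal_mult)
      also have "\<dots> = ennreal (a / ?D)"
        using assms(3) D by (rule divide_ennreal)
      finally show ?thesis using D assms(3) by (simp add: ennreal_le_iff pos_le_divide_eq)
    qed (use assms in simp)
  qed
qed

text \<open>Take the \<open>k\<close>-th power. The resulting denominator \<open>b ^ k\<close> is
  weakened to \<open>b\<close>, so that all orders share one bound.\<close>

lemma root_bound_power:
  fixes x t \<sigma> p b :: real
  assumes "x \<ge> 0" "t \<ge> 0" "\<sigma> > 0" "p > 0" "b \<ge> 1" "k \<ge> 1"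
    and le: "p * b * (\<sigma> * x powr (1 / real k)) \<le> sqrt 2 * t powr (1 / real k)"
  shows "(\<sigma> * p / sqrt 2) ^ k * x \<le> t / b"
proof -
  have root: "(z powr (1 / real k)) ^ k = z" if "z \<ge> 0" for z
    using that assms(6) by (cases "z = 0") (auto simp: powr_power)
  have "\<sigma> * p / sqrt 2 * x powr (1 / real k) \<le> t powr (1 / real k) / b"
    using le assms(5) by (simp add: field_simps)
  then have "(\<sigma> * p / sqrt 2 * x powr (1 / real k)) ^ k \<le> (t powr (1 / real k) / b) ^ k"
    using assms by (intro power_mono) auto
  then have "(\<sigma> * p / sqrt 2) ^ k * x \<le> t / b ^ k"
    using root assms by (simp add: power_mult_distrib power_divide)
  also have "\<dots> \<le> t / b"
    using assms self_le_power[of b k] by (intro divide_left_mono) auto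
  finally show ?thesis .
qed

section \<open>From a lower bound on \<open>eta\<close> to moments and tails\<close>

context poincare_space
begin

text \<open>A finite extended norm gives integrability, so the real-valued \<open>lp_norm\<close> is
  the true norm and not the default 0.\<close>

lemma op_norm_Lp_2:
  assumes "op_norm_Lp \<mu> k 2 f = ennreal x" "x \<ge> 0" "Ck_on k G f" "k \<ge> 1"
  shows "integrable \<mu> (\<lambda>x. op_norm k f x powr 2)" "lp_norm \<mu> 2 (op_norm k f) = x"
proof -
  let ?g = "\<lambda>x. op_norm k f x powr 2"
  let ?I = "\<integral>\<^sup>+x. ennreal (?g x) \<partial>\<mu>"
  have [measurable]: "op_norm k f \<in> borel_measurable \<mu>"
    using assms by (intro measurable_continuous op_norm_continuous)
  have fin: "?I \<noteq> \<infinity>"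
    using assms(1) by (auto simp: op_norm_Lp_def ennreal_powr_def)
  then show int: "integrable \<mu> ?g"
    by (intro integrableI_bounded) (auto simp: less_top)
  have "x = enn2real ?I powr (1 / 2)"
    using assms(1,2) fin by (simp add: op_norm_Lp_def ennreal_powr_def)
  also have "enn2real ?I = (\<integral>x. ?g x \<partial>\<mu>)"
    using int by (simp add: integral_eq_nn_integral)
  finally show "lp_norm \<mu> 2 (op_norm k f) = x" by (simp add: lp_norm_def)
qed

lemma op_norm_Linf:
  assumes "op_norm_Linf \<mu> k f = ennreal x" "x \<ge> 0" "Ck_on k G f" "k \<ge> 1" "p > 0"
  shows "integrable \<mu> (\<lambda>x. op_norm k f x powr p)" "lp_norm \<mu> p (op_norm k f) \<le> x"
proof -
  have nonneg: "op_norm k f y \<ge> 0" for y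
    using assms(4) op_norm_nonneg by (cases k) auto
  have [measurable]: "op_norm k f \<in> borel_measurable \<mu>"
    using assms by (intro measurable_continuous op_norm_continuous)
  have "AE y in \<mu>. ennreal (op_norm k f y) \<le> ennreal x"
    using esssup_AE[of "\<lambda>y. ennreal (op_norm k f y)" \<mu>] assms(1) by (simp add: op_norm_Linf_def)
  then have AE: "AE y in \<mu>. op_norm k f y powr p \<le> x powr p"
    by eventually_elim (use assms nonneg in \<open>auto simp: ennreal_le_iff intro!: powr_mono2\<close>)
  then show int: "integrable \<mu> (\<lambda>x. op_norm k f x powr p)"
    by (intro integrable_const_bound[of _ "x powr p"]) auto
  have "(\<integral>y. op_norm k f y powr p \<partial>\<mu>) \<le> (\<integral>y. x powr p \<partial>\<mu>)"
    using int AE by (intro integral_mono_AE) auto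
  then have "lp_norm \<mu> p (op_norm k f) \<le> (x powr p) powr (1 / p)"
    unfolding lp_norm_def using assms by (intro powr_mono2) (auto simp: prob_space)
  then show "lp_norm \<mu> p (op_norm k f) \<le> x"
    using assms by (simp add: powr_powr)
qed

text \<open>The lower bound on \<open>eta\<close> makes each of \<open>d\<close> terms at most
  \<open>t / (d * exp 1)\<close>. Together they bound the p-norm of \<open>f\<close> by
  \<open>t / exp 1\<close>, and Markov's inequality for the p-th power leaves exp (-p).\<close>

lemma tail_bound:
  fixes f :: "real ^ 'n \<Rightarrow> real"
  assumes d: "d \<ge> 1" and f: "Ck_on d G f" "integrable \<mu> f" "(\<integral>x. f x \<partial>\<mu>) = 0" and t: "t \<ge> 0"
    and p: "p > 2" "ennreal (p * (real d * exp 1)) \<le> eta \<mu> d \<sigma> f t"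
  shows "measure \<mu> {x \<in> space \<mu>. \<bar>f x\<bar> \<ge> t} \<le> exp (- p)"
proof -
  define b where "b = real d * exp 1"
  have "1 * 1 \<le> real d * exp 1" using d by (intro mult_mono) auto
  then have b: "b \<ge> 1" "b > 0" by (auto simp: b_def)
  define s where "s = \<sigma> * p / sqrt 2"
  have s: "s > 0" using \<sigma>_pos p by (simp add: s_def)
  have pb: "p * b > 0" using p b by simp
  let ?g = "\<lambda>k. op_norm k f"
  have le_inf: "ennreal (p * b) \<le> ennreal (sqrt 2 * t powr (1 / real d))
      / (ennreal \<sigma> * ennreal_powr (op_norm_Linf \<mu> d f) (1 / real d))"
    using p(2) unfolding eta_def b_def by simp
  \<comment> \<open>For \<open>t = 0\<close> the quotient is 0 whatever its denominator, against the
    positive lower bound.\<close>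
  have "t \<noteq> 0"
  proof
    assume "t = 0"
    then have "ennreal (p * b) \<le> 0" using le_inf by simp
    then show False using p b by auto
  qed
  then have t_pos: "t > 0" using t by simp
  have L2: "integrable \<mu> (\<lambda>x. ?g k x powr 2)" "s ^ k * lp_norm \<mu> 2 (?g k) \<le> t / b"
    if k: "1 \<le> k" "k < d" for k
  proof -
    have "ennreal (p * b) \<le> (INF k\<in>{1..d - 1}. ennreal (sqrt 2 * t powr (1 / real k))
          / (ennreal \<sigma> * ennreal_powr (op_norm_Lp \<mu> k 2 f) (1 / real k)))"
      using p(2) unfolding eta_def b_def by simp
    also have "\<dots> \<le> ennreal (sqrt 2 * t powr (1 / real k))
          / (ennreal \<sigma> * ennreal_powr (op_norm_Lp \<mu> k 2 f) (1 / real k))"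
      using k by (intro INF_lower) auto
    finally obtain x where x: "x \<ge> 0" "op_norm_Lp \<mu> k 2 f = ennreal x"
        "p * b * (\<sigma> * x powr (1 / real k)) \<le> sqrt 2 * t powr (1 / real k)"
      using ennreal_quotient_bound[OF _ pb _ \<sigma>_pos] by (metis mult_nonneg_nonneg powr_ge_zero real_sqrt_ge_0_iff zero_le_numeral)
    have "Ck_on k G f" using f(1) k by (auto intro: Ck_on_mono)
    from op_norm_Lp_2[OF x(2,1) this k(1)]
    show "integrable \<mu> (\<lambda>x. ?g k x powr 2)" "s ^ k * lp_norm \<mu> 2 (?g k) \<le> t / b"
      using root_bound_power[OF x(1) t \<sigma>_pos _ b(1) k(1) x(3)] p by (auto simp: s_def)
  qed
  have Linf: "integrable \<mu> (\<lambda>x. ?g d x powr p)" "s ^ d * lp_norm \<mu> p (?g d) \<le> t / b"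
  proof -
    obtain x where x: "x \<ge> 0" "op_norm_Linf \<mu> d f = ennreal x"
        "p * b * (\<sigma> * x powr (1 / real d)) \<le> sqrt 2 * t powr (1 / real d)"
      using ennreal_quotient_bound[OF le_inf pb _ \<sigma>_pos] by auto
    show "integrable \<mu> (\<lambda>x. ?g d x powr p)"
      using op_norm_Linf(1)[OF x(2,1) f(1) d] p by simp
    have "s ^ d * lp_norm \<mu> p (?g d) \<le> s ^ d * x"
      using op_norm_Linf(2)[OF x(2,1) f(1) d] p s by (intro mult_left_mono) auto
    also have "\<dots> \<le> t / b"
      using root_bound_power[OF x(1) t \<sigma>_pos _ b(1) d x(3)] p by (simp add: s_def)
    finally show "s ^ d * lp_norm \<mu> p (?g d) \<le> t / b" .
  qed
  have slope: "slope_on G (?g k) (?g (Suc k))" "continuous_on G (?g (Suc k))" if "k < d" for k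
    using that by (intro op_norm_slope op_norm_continuous open_G Ck_on_mono[OF f(1)]; simp)+
  \<comment> \<open>Downward induction from order \<open>d\<close>: every step adds one 2-norm term,
    and the count \<open>d + 1 - j\<close> reaches \<open>d\<close> at \<open>j = 1\<close>. Order 0
    adds no term because \<open>f\<close> is centred, so the step to \<open>f\<close> itself is
    \<open>moment_step_centered\<close>.\<close>
  have "integrable \<mu> (\<lambda>x. ?g 1 x powr p) \<and> s ^ 1 * lp_norm \<mu> p (?g 1) \<le> real (d + 1 - 1) * (t / b)"
    using d
  proof (rule inc_induct[where P = "\<lambda>j. integrable \<mu> (\<lambda>x. ?g j x powr p) \<and>
        s ^ j * lp_norm \<mu> p (?g j) \<le> real (d + 1 - j) * (t / b)"])
    show "integrable \<mu> (\<lambda>x. ?g d x powr p) \<and> s ^ d * lp_norm \<mu> p (?g d) \<le> real (d + 1 - d) * (t / b)"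
      using Linf by simp
  next
    fix n assume n: "1 \<le> n" "n < d"
      and IH: "integrable \<mu> (\<lambda>x. ?g (Suc n) x powr p) \<and> s ^ Suc n * lp_norm \<mu> p (?g (Suc n)) \<le> real (d + 1 - Suc n) * (t / b)"
    have nonneg: "0 \<le> ?g n x" "0 \<le> ?g (Suc n) x" for x
      using op_norm_nonneg[of n f x] op_norm_nonneg[of "n - 1" f x] n by auto
    note prems = slope(1)[OF n(2)] nonneg(1) L2(1)[OF n] slope(2)[OF n(2)] nonneg(2) conjunct1[OF IH] p(1)
    have "s ^ n * lp_norm \<mu> p (?g n) \<le> s ^ n * (lp_norm \<mu> 2 (?g n) + s * lp_norm \<mu> p (?g (Suc n)))"
      using moment_step[OF prems] s by (intro mult_left_mono) (auto simp: s_def)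
    also have "\<dots> = s ^ n * lp_norm \<mu> 2 (?g n) + s ^ Suc n * lp_norm \<mu> p (?g (Suc n))"
      by (simp add: distrib_left)
    also have "\<dots> \<le> t / b + real (d + 1 - Suc n) * (t / b)"
      using L2(2)[OF n] IH by (intro add_mono) auto
    also have "\<dots> = real (d + 1 - n) * (t / b)"
      using n by (simp add: of_nat_diff algebra_simps add_divide_distrib diff_divide_distrib)
    finally show "integrable \<mu> (\<lambda>x. ?g n x powr p) \<and> s ^ n * lp_norm \<mu> p (?g n) \<le> real (d + 1 - n) * (t / b)"
      using moment(1)[OF prems] by simp
  qed
  then have g1: "integrable \<mu> (\<lambda>x. ?g 1 x powr p)" "s * lp_norm \<mu> p (?g 1) \<le> t / exp 1"
    using d by (auto simp: b_def)
  have "slope_on G f (?g 1)"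
    using slope(1)[of 0] d by (simp add: op_norm_0[abs_def])
  note centered = moment_step_centered[OF this f(2,3) _ _ g1(1) p(1)]
  have cont1: "continuous_on G (?g 1)" using slope(2)[of 0] d by simp
  have nonneg1: "0 \<le> ?g 1 x" for x using op_norm_nonneg[of 0 f x] by simp
  have int: "integrable \<mu> (\<lambda>x. \<bar>f x\<bar> powr p)" by (rule centered(1)[OF cont1 nonneg1])
  have lp: "lp_norm \<mu> p (\<lambda>x. \<bar>f x\<bar>) \<le> t / exp 1"
    using centered(2)[OF cont1 nonneg1] g1(2) by (simp add: s_def)
  have "{x \<in> space \<mu>. \<bar>f x\<bar> \<ge> t} = {x \<in> space \<mu>. \<bar>f x\<bar> powr p \<ge> t powr p}"
  proof (intro Collect_cong conj_cong refl)
    show "t \<le> \<bar>f x\<bar> \<longleftrightarrow> t powr p \<le> \<bar>f x\<bar> powr p" for x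
      using t p powr_mono2[of p t "\<bar>f x\<bar>"] powr_less_mono2[of p "\<bar>f x\<bar>" t] by linarith
  qed
  then have "measure \<mu> {x \<in> space \<mu>. \<bar>f x\<bar> \<ge> t} \<le> (\<integral>x. \<bar>f x\<bar> powr p \<partial>\<mu>) / t powr p"
    using integral_Markov_inequality_measure[OF int, of "{}" "t powr p"] t_pos by simp
  also have "(\<integral>x. \<bar>f x\<bar> powr p \<partial>\<mu>) = lp_norm \<mu> p (\<lambda>x. \<bar>f x\<bar>) powr p"
    using p by (simp add: lp_norm_powr_self)
  also have "\<dots> / t powr p \<le> (t / exp 1) powr p / t powr p"
    using lp p by (intro divide_right_mono powr_mono2 lp_norm_nonneg) auto
  also have "\<dots> = 1 / exp 1 powr p"
    using t_pos by (simp add: powr_divide)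
  also have "\<dots> = exp (- p)"
    by (simp add: powr_def exp_minus divide_inverse)
  finally show ?thesis .
qed

end

theorem corollary1p3:
  fixes G :: "(real ^ 'n::finite) set"
    and \<mu> :: "(real ^ 'n) measure"
    and \<sigma> t :: real
    and d :: nat
    and f :: "real ^ 'n \<Rightarrow> real"
  assumes "d \<ge> 1"
    and "open G"
    and "prob_space \<mu>"
    and "sets \<mu> = sets (restrict_space borel G)"
    and "\<sigma> > 0"
    and "poincare_type G \<mu> (\<sigma>\<^sup>2)"
    and "Ck_on d G f"
    and "integrable \<mu> f"
    and "(\<integral>x. f x \<partial>\<mu>) = 0"
    and "t \<ge> 0"
  shows "measure \<mu> {x \<in> space \<mu>. \<bar>f x\<bar> \<ge> t}
           \<le> (exp 1)\<^sup>2 * exp_minus (eta \<mu> d \<sigma> f t / ennreal (real d * exp 1))"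
proof -
  interpret prob_space \<mu> by fact
  interpret poincare_space \<mu> G \<sigma> by standard fact+
  let ?m = "measure \<mu> {x \<in> space \<mu>. \<bar>f x\<bar> \<ge> t}" and ?b = "real d * exp 1"
  note tail = tail_bound[OF assms(1,7,8,9,10)]
  have b: "?b > 0" using assms(1) by simp
  show ?thesis
  proof (cases "eta \<mu> d \<sigma> f t / ennreal ?b" rule: ennreal_cases)
    \<comment> \<open>An infinite exponent admits every \<open>p > 2\<close> in the tail bound; let
      \<open>p\<close> tend to infinity.\<close>
    case top
    then have "eta \<mu> d \<sigma> f t = top"
      using b assms(1) by (simp add: ennreal_divide_eq_top_iff)
    then have "?m \<le> exp (- p)" if "p > 2" for p using tail[OF that] by simp
    moreover have "((\<lambda>p::real. exp (- p)) \<longlongrightarrow> 0) at_top"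
      by (intro filterlim_compose[OF exp_at_bot] filterlim_uminus_at_bot_at_top)
    ultimately have "?m \<le> 0"
      by (intro tendsto_lowerbound[of "\<lambda>p::real. exp (- p)" 0 at_top])
        (auto intro: eventually_mono[OF eventually_gt_at_top[of 2]])
    then show ?thesis by (simp add: exp_minus_def top)
  next
    case (real r)
    have e2: "(exp 1)\<^sup>2 * exp (- r) = exp (2 - r)"
      by (simp add: exp_diff exp_minus exp_of_nat_mult[of 2 1, simplified, symmetric] divide_inverse)
    have "?m \<le> exp (2 - r)"
    proof (cases "r > 2")
      case True
      have "eta \<mu> d \<sigma> f t = ennreal r * ennreal ?b"
        using real b by (metis ennreal_divide_times ennreal_eq_0_iff ennreal_neq_top mult_divide_eq_ennreal not_le)
      then have "?m \<le> exp (- r)"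
        using tail[OF True] real b by (simp add: ennreal_mult'[symmetric])
      then show ?thesis by (rule order_trans) simp
    next
      case False
      then have "1 \<le> exp (2 - r)" by simp
      with prob_le_1 show ?thesis by (rule order_trans)
    qed
    then show ?thesis using real by (simp add: exp_minus_def e2)
  qed
qed

end
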